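(* Let $(U_h^n,V_h^n)_{n=0}^N$ be a solution of the fully discrete scheme described in the context, and set $\overline V_h^{n+1}:=V_h^{n+1}-P_h\delta W^n$. Then the scheme exactly preserves the Hamiltonian in the sense that $$J(U_h^{n+1},\overline V_h^{n+1})=J(U_h^n,V_h^n),\qquad n=0,1,\dots,N-1,$$ almost surely.
   Context: Setting. Let $d\in\{1,2\}$, let $\mathcal D\subset\mathbb R^d$ be a bounded convex domain with polygonal boundary, $H=L^2(\mathcal D)$ with inner product $\langle\cdot,\cdot\rangle$ and norm $\|\cdot\|$, and $T>0$. $(\Omega,\mathcal F,\mathbb P,\{\mathcal F_t\})$ is a filtered probability space with normal filtration. $\Lambda=-\Delta$ with Dirichlet boundary conditions, $\dot H^\alpha=D(\Lambda^{\alpha/2})$, $\mathbb H^\alpha=\dot H^\alpha\times\dot H^{\alpha-1}$; $\mathcal L_2(H)$ denotes the Hilbert–Schmidt operators on $H$. Nonlinearity. $f$ is a real cubic polynomial with primitive $F$ ($F'=f$), and there are positive constants $a_1,a_2,b_1,b_2$ with $a_1\|u\|_{L^4}^4-b_1\le\int_{\mathcal D}F(u)\,dx\le a_2\|u\|_{L^4}^4-b_2$ for all $u\in L^4(\mathcal D)$; moreover there is $c>0$ with $-\langle f(u)-f(v),u-v\rangle\le c\|u-v\|^2$ for all $u,v\in H$ (pairing understood as the integral over $\mathcal D$). Noise and initial value. $W$ is an $H$-valued $Q$-Wiener process with respect to $\{\mathcal F_t\}$, $Q\in\mathcal L(H)$ self-adjoint, positive semi-definite, with $\|\Lambda^{\frac{\gamma-1}{2}}Q^{1/2}\|_{\mathcal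 L_2(H)}<\infty$ for some $\gamma\in[1,\infty)$ if $d=1$, $\gamma\in[1,3]$ if $d=2$; $X_0=[u_0,v_0]^\top$ is $\mathcal F_0$-measurable with $\mathbb E\|X_0\|_{\mathbb H^\gamma}^{p_0}<\infty$ for a sufficiently large $p_0\in\mathbb N$. Energy. $J(u,v)=\tfrac12\|\nabla u\|^2+\tfrac12\|v\|^2+\int_{\mathcal D}F(u)\,dx+C_1$, with a fixed constant $C_1\ge b_1$. Discrete space. $V_h\subset H_0^1(\mathcal D)$ is finite-dimensional; $\Lambda_h:V_h\to V_h$ is defined by $\langle\Lambda_hv_h,\chi_h\rangle=\langle\nabla v_h,\nabla\chi_h\rangle$ for $v_h,\chi_h\in V_h$; $P_h:\dot H^{-1}\to V_h$ is defined by $\langle P_hv,\chi_h\rangle=\langle v,\chi_h\rangle$ for all $\chi_h\in V_h$. Scheme. $N\in\mathbb N^+$, $\tau=T/N$, $t_n=n\tau$, $\delta W^n=W(t_{n+1})-W(t_n)$, $C_h(\tau)=\cos(\tau\Lambda_h^{1/2})$, $S_h(\tau)=\sin(\tau\Lambda_h^{1/2})$, $U_h^0=P_hu_0$, $V_h^0=P_hv_0$, and for $n=0,\dots,N-1$ the $V_h$-valued random variables satisfy $$U_h^{n+1}=C_h(\tau)U_h^n+\Lambda_h^{-1/2}S_h(\tau)V_h^n-\Lambda_h^{-1}(I-C_h(\tau))P_h\int_0^1f(U_h^n+\theta(U_h^{n+1}-U_h^n))\,d\theta,$$ $$V_h^{n+1}=-\Lambda_h^{1/2}S_h(\tau)U_h^n+C_h(\tau)V_h^n-\Lambda_h^{-1/2}S_h(\tau)P_h\int_0^1f(U_h^n+\theta(U_h^{n+1}-U_h^n))\,d\theta+P_h\delta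 W^n.$$ *)

theory Defs
  imports
    "HOL-Analysis.Analysis"
    "HOL-Probability.Probability"
    "HOL-Computational_Algebra.Polynomial"
begin

section \<open>The space of square-integrable functions\<close>

definition sq_integrable :: "('a::euclidean_space \<Rightarrow> real) \<Rightarrow> bool" where
  "sq_integrable f \<longleftrightarrow> f \<in> borel_measurable borel \<and> integrable lborel (\<lambda>x. (f x)\<^sup>2)"

definition l2rel :: "('a::euclidean_space \<Rightarrow> real) \<Rightarrow> ('a \<Rightarrow> real) \<Rightarrow> bool" where
  "l2rel f g \<longleftrightarrow> sq_integrable f \<and> sq_integrable g \<and> (AE x in lborel. f x = g x)"

lemma sq_integrable_zero: "sq_integrable (\<lambda>_. 0)"
  by (simp add: sq_integrable_def)

lemma sq_integrable_mult:
  assumes "sq_integrable f" "sq_integrable g"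
  shows "integrable lborel (\<lambda>x. f x * g x)"
proof (rule Bochner_Integration.integrable_bound)
  show "integrable lborel (\<lambda>x. (f x)\<^sup>2 + (g x)\<^sup>2)"
    using assms by (simp add: sq_integrable_def)
  show "(\<lambda>x. f x * g x) \<in> borel_measurable lborel"
    using assms by (auto simp: sq_integrable_def)
  have "\<bar>a * b\<bar> \<le> a\<^sup>2 + b\<^sup>2" for a b :: real
  proof -
    have "2 * (\<bar>a\<bar> * \<bar>b\<bar>) \<le> a\<^sup>2 + b\<^sup>2"
      using sum_squares_bound[of "\<bar>a\<bar>" "\<bar>b\<bar>"] by simp
    moreover have "0 \<le> \<bar>a\<bar> * \<bar>b\<bar>" by simp
    ultimately show ?thesis unfolding abs_mult by linarith
  qed
  then show "AE x in lborel. norm (f x * g x) \<le> norm ((f x)\<^sup>2 + (g x)\<^sup>2)"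
    by simp
qed

lemma sq_integrable_add:
  assumes "sq_integrable f" "sq_integrable g"
  shows "sq_integrable (\<lambda>x. f x + g x)"
  using assms sq_integrable_mult[OF assms]
  by (auto simp: sq_integrable_def power2_sum mult.assoc)

lemma sq_integrable_scale:
  assumes "sq_integrable f" shows "sq_integrable (\<lambda>x. r * f x)"
  using assms by (auto simp: sq_integrable_def power_mult_distrib)

lemma l2rel_ext:
  assumes "sq_integrable f" "\<And>x. f x = g x"
  shows "l2rel f g"
proof -
  have "f = g" by (rule ext) (fact assms(2))
  then show ?thesis using assms(1) by (simp add: l2rel_def)
qed

quotient_type (overloaded) 'a l2 = "'a::euclidean_space \<Rightarrow> real" / partial: l2rel
proof (rule part_equivpI)
  show "\<exists>f::'a \<Rightarrow> real. l2rel f f"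
    using l2rel_ext[OF sq_integrable_zero refl] by blast
  show "symp (l2rel :: ('a \<Rightarrow> real) \<Rightarrow> _)"
  proof (rule sympI)
    fix f g :: "'a \<Rightarrow> real" assume fg: "l2rel f g"
    then have "AE x in lborel. f x = g x" by (simp add: l2rel_def)
    then have "AE x in lborel. g x = f x" by eventually_elim simp
    then show "l2rel g f" using fg by (simp add: l2rel_def)
  qed
  show "transp (l2rel :: ('a \<Rightarrow> real) \<Rightarrow> _)"
  proof (rule transpI)
    fix f g h :: "'a \<Rightarrow> real"
    assume fg: "l2rel f g" and gh: "l2rel g h"
    have "AE x in lborel. f x = g x" "AE x in lborel. g x = h x"
      using fg gh by (simp_all add: l2rel_def)
    then have "AE x in lborel. f x = h x" by eventually_elim simp
    then show "l2rel f h" using fg gh by (simp add: l2rel_def)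
  qed
qed

text \<open>\<^term>\<open>rep_l2 u\<close> is a square-integrable Borel representative of the class \<^term>\<open>u\<close>, and
  \<^term>\<open>abs_l2 f\<close> is the class of a square-integrable Borel function \<^term>\<open>f\<close>.\<close>

instantiation l2 :: (euclidean_space) real_inner
begin

lift_definition zero_l2 :: "'a l2" is "\<lambda>_. 0"
  by (simp add: l2rel_def sq_integrable_zero)

lift_definition plus_l2 :: "'a l2 \<Rightarrow> 'a l2 \<Rightarrow> 'a l2" is "\<lambda>f g x. f x + g x"
  unfolding l2rel_def by (auto intro: sq_integrable_add)

lift_definition scaleR_l2 :: "real \<Rightarrow> 'a l2 \<Rightarrow> 'a l2" is "\<lambda>r f x. r * f x"
  unfolding l2rel_def by (auto intro: sq_integrable_scale)

lift_definition inner_l2 :: "'a l2 \<Rightarrow> 'a l2 \<Rightarrow> real" is "\<lambda>f g. \<integral>x. f x * g x \<partial>lborel"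
  by (rule integral_cong_AE) (auto simp: l2rel_def sq_integrable_def)

definition uminus_l2 :: "'a l2 \<Rightarrow> 'a l2" where "uminus_l2 u = (-1) *\<^sub>R u"
definition minus_l2 :: "'a l2 \<Rightarrow> 'a l2 \<Rightarrow> 'a l2" where "minus_l2 u v = u + (-1) *\<^sub>R v"
definition norm_l2 :: "'a l2 \<Rightarrow> real" where "norm_l2 u = sqrt (inner u u)"
definition sgn_l2 :: "'a l2 \<Rightarrow> 'a l2" where "sgn_l2 u = inverse (norm u) *\<^sub>R u"
definition dist_l2 :: "'a l2 \<Rightarrow> 'a l2 \<Rightarrow> real" where "dist_l2 u v = norm (u - v)"
definition uniformity_l2 :: "('a l2 \<times> 'a l2) filter" where
  "uniformity_l2 = (INF e\<in>{0<..}. principal {(u, v). dist u v < e})"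
definition open_l2 :: "'a l2 set \<Rightarrow> bool" where
  "open_l2 U \<longleftrightarrow> (\<forall>u\<in>U. \<forall>\<^sub>F (u', v) in uniformity. u' = u \<longrightarrow> v \<in> U)"

instance
proof
  fix u v w :: "'a l2" and r s :: real
  note [intro] = sq_integrable_add sq_integrable_scale
  have l2relD: "sq_integrable f" if "l2rel f f" for f :: "'a \<Rightarrow> real"
    using that by (simp add: l2rel_def)
  show "u + v + w = u + (v + w)"
    by transfer (rule l2rel_ext, auto dest!: l2relD)
  show "u + v = v + u"
    by transfer (rule l2rel_ext, auto dest!: l2relD)
  show "0 + u = u"
    by transfer (simp add: l2rel_def)
  show "r *\<^sub>R (u + v) = r *\<^sub>R u + r *\<^sub>R v"
    by transfer (rule l2rel_ext, auto dest!: l2relD simp: distrib_left)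
  show "(r + s) *\<^sub>R u = r *\<^sub>R u + s *\<^sub>R u"
    by transfer (rule l2rel_ext, auto dest!: l2relD simp: distrib_right)
  show "r *\<^sub>R s *\<^sub>R u = (r * s) *\<^sub>R u"
    by transfer (rule l2rel_ext, auto dest!: l2relD)
  show "1 *\<^sub>R u = u"
    by transfer (simp add: l2rel_def)
  show "- u + u = 0"
    unfolding uminus_l2_def
    by transfer (simp add: l2rel_def sq_integrable_zero)
  show "u - v = u + - v"
    by (simp add: uminus_l2_def minus_l2_def)
  show "inner u v = inner v u"
    by transfer (simp add: mult.commute)
  show "inner (u + v) w = inner u w + inner v w"
    by transfer (auto simp: l2rel_def distrib_right sq_integrable_mult)
  show "inner (r *\<^sub>R u) v = r * inner u v"
    by transfer (auto simp: mult.assoc)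
  show "0 \<le> inner u u"
    by transfer auto
  show "inner u u = 0 \<longleftrightarrow> u = 0"
  proof transfer
    fix f :: "'a \<Rightarrow> real" assume "l2rel f f"
    then have f: "sq_integrable f" by (simp add: l2rel_def)
    have "(\<integral>x. f x * f x \<partial>lborel) = 0 \<longleftrightarrow> (AE x in lborel. f x * f x = 0)"
      by (rule integral_nonneg_eq_0_iff_AE[OF sq_integrable_mult[OF f f]]) simp
    then show "(\<integral>x. f x * f x \<partial>lborel) = 0 \<longleftrightarrow> l2rel f (\<lambda>_. 0)"
      using f by (simp add: l2rel_def sq_integrable_zero)
  qed
  show "norm u = sqrt (inner u u)" by (fact norm_l2_def)
  show "sgn u = inverse (norm u) *\<^sub>R u" by (fact sgn_l2_def)
  show "dist u v = norm (u - v)" by (fact dist_l2_def)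
  show "uniformity = (INF e\<in>{0<..}. principal {(u :: 'a l2, v). dist u v < e})"
    by (fact uniformity_l2_def)
  show "open U \<longleftrightarrow> (\<forall>u\<in>U. \<forall>\<^sub>F (u', v) in uniformity. u' = u \<longrightarrow> v \<in> U)" for U :: "'a l2 set"
    by (fact open_l2_def)
qed

end

text \<open>The space \<open>L\<^sup>2(D)\<close>, realised by extension by zero as the closed subspace of \<open>L\<^sup>2\<close> of the
  whole space whose elements vanish almost everywhere outside \<^term>\<open>D\<close>.\<close>

definition L2 :: "'a::euclidean_space set \<Rightarrow> 'a l2 set" where
  "L2 D = {u. AE x in lborel. x \<notin> D \<longrightarrow> rep_l2 u x = 0}"

definition polygonal_domain :: "'a::euclidean_space set \<Rightarrow> bool" where
  "polygonal_domain D \<longleftrightarrow> open D \<and> D \<noteq> {} \<and> bounded D \<and> convex D \<and> polytope (closure D)"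


section \<open>Sobolev space and Dirichlet Laplacian\<close>

definition pderivative :: "'a::euclidean_space \<Rightarrow> ('a \<Rightarrow> real) \<Rightarrow> 'a \<Rightarrow> real" where
  "pderivative i \<phi> x = frechet_derivative \<phi> (at x) i"

primrec C_k :: "nat \<Rightarrow> ('a::euclidean_space \<Rightarrow> real) \<Rightarrow> bool" where
  "C_k 0 \<phi> \<longleftrightarrow> continuous_on UNIV \<phi>"
| "C_k (Suc k) \<phi> \<longleftrightarrow> (\<forall>x. \<phi> differentiable (at x)) \<and> (\<forall>i\<in>Basis. C_k k (pderivative i \<phi>))"

definition test_functions :: "'a::euclidean_space set \<Rightarrow> ('a \<Rightarrow> real) set" where
  "test_functions D = {\<phi>. (\<forall>k. C_k k \<phi>) \<and> compact (closure {x. \<phi> x \<noteq> 0}) \<and>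
     closure {x. \<phi> x \<noteq> 0} \<subseteq> D}"

definition is_weak_partial ::
  "'a::euclidean_space set \<Rightarrow> 'a \<Rightarrow> 'a l2 \<Rightarrow> 'a l2 \<Rightarrow> bool" where
  "is_weak_partial D i u g \<longleftrightarrow> g \<in> L2 D \<and> (\<forall>\<phi>\<in>test_functions D.
     (\<integral>x. rep_l2 u x * pderivative i \<phi> x \<partial>lborel) = - (\<integral>x. rep_l2 g x * \<phi> x \<partial>lborel))"

definition weak_partial :: "'a::euclidean_space set \<Rightarrow> 'a \<Rightarrow> 'a l2 \<Rightarrow> 'a l2" where
  "weak_partial D i u = (THE g. is_weak_partial D i u g)"

text \<open>\<open>H\<^sub>0\<^sup>1(D)\<close> is the closure of the test functions in the norm of \<open>H\<^sup>1(D)\<close>.\<close>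

definition H01 :: "'a::euclidean_space set \<Rightarrow> 'a l2 set" where
  "H01 D = {u \<in> L2 D. \<exists>\<phi> :: nat \<Rightarrow> 'a \<Rightarrow> real. (\<forall>k. \<phi> k \<in> test_functions D) \<and>
     (\<lambda>k. abs_l2 (\<phi> k)) \<longlonglongrightarrow> u \<and>
     (\<forall>i\<in>Basis. \<exists>g. is_weak_partial D i u g \<and> (\<lambda>k. abs_l2 (pderivative i (\<phi> k))) \<longlonglongrightarrow> g)}"

definition grad_inner :: "'a::euclidean_space set \<Rightarrow> 'a l2 \<Rightarrow> 'a l2 \<Rightarrow> real" where
  "grad_inner D u v = (\<Sum>i\<in>Basis. inner (weak_partial D i u) (weak_partial D i v))"

text \<open>The operator \<open>-\<Delta>\<close> with Dirichlet boundary conditions: the self-adjoint operator of the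
  form \<^term>\<open>grad_inner D\<close> on \<^term>\<open>H01 D\<close>.\<close>

definition dom_laplacian :: "'a::euclidean_space set \<Rightarrow> 'a l2 set" where
  "dom_laplacian D = {u \<in> H01 D. \<exists>w\<in>L2 D. \<forall>\<psi>\<in>H01 D. inner w \<psi> = grad_inner D u \<psi>}"

definition laplacian :: "'a::euclidean_space set \<Rightarrow> 'a l2 \<Rightarrow> 'a l2" where
  "laplacian D u = (THE w. w \<in> L2 D \<and> (\<forall>\<psi>\<in>H01 D. inner w \<psi> = grad_inner D u \<psi>))"


section \<open>Functions of self-adjoint operators\<close>

text \<open>The element of \<^term>\<open>V\<close> that represents the functional \<^term>\<open>l\<close>. For \<^term>\<open>l = inner u\<close> it is
  the orthogonal projection of \<^term>\<open>u\<close> onto \<^term>\<open>V\<close>.\<close>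

definition riesz :: "'b::real_inner set \<Rightarrow> ('b \<Rightarrow> real) \<Rightarrow> 'b" where
  "riesz V l = (THE w. w \<in> V \<and> (\<forall>\<psi>\<in>V. inner w \<psi> = l \<psi>))"

definition eigenspace :: "'b::real_inner set \<Rightarrow> ('b \<Rightarrow> 'b) \<Rightarrow> real \<Rightarrow> 'b set" where
  "eigenspace E A \<mu> = {w \<in> E. A w = \<mu> *\<^sub>R w}"

definition eigenvalues :: "'b::real_inner set \<Rightarrow> ('b \<Rightarrow> 'b) \<Rightarrow> real set" where
  "eigenvalues E A = {\<mu>. \<exists>w\<in>eigenspace E A \<mu>. w \<noteq> 0}"

text \<open>The spectral representation \<open>g(A) = \<Sum>\<^sub>\<mu> g(\<mu>) \<Pi>\<^sub>\<mu>\<close> with \<open>\<Pi>\<^sub>\<mu>\<close> the orthogonal projection onto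
  the eigenspace of \<open>\<mu>\<close>. It is only used for self-adjoint operators with finite-dimensional
  eigenspaces that span a dense subspace: the Dirichlet Laplacian, whose resolvent is compact, and
  its discrete version on a finite-dimensional space.\<close>

definition spectral_fun ::
  "'b::real_inner set \<Rightarrow> ('b \<Rightarrow> 'b) \<Rightarrow> (real \<Rightarrow> real) \<Rightarrow> 'b \<Rightarrow> 'b" where
  "spectral_fun E A g u =
     (\<Sum>\<^sub>\<infinity>\<mu>\<in>eigenvalues E A. g \<mu> *\<^sub>R riesz (eigenspace E A \<mu>) (inner u))"

definition laplacian_pow :: "'a::euclidean_space set \<Rightarrow> real \<Rightarrow> 'a l2 \<Rightarrow> 'a l2" where
  "laplacian_pow D s = spectral_fun (dom_laplacian D) (laplacian D) (\<lambda>\<mu>. \<mu> powr s)"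

text \<open>The domain of the power \<open>s \<ge> 0\<close> of the Dirichlet Laplacian; negative powers, whose domains
  are not contained in \<open>L\<^sup>2(D)\<close>, do not occur.\<close>

definition dom_laplacian_pow :: "'a::euclidean_space set \<Rightarrow> real \<Rightarrow> 'a l2 set" where
  "dom_laplacian_pow D s = {u \<in> L2 D.
     (\<lambda>\<mu>. (\<mu> powr s * norm (riesz (eigenspace (dom_laplacian D) (laplacian D) \<mu>) (inner u)))\<^sup>2)
       summable_on eigenvalues (dom_laplacian D) (laplacian D)}"

definition Hdot :: "'a::euclidean_space set \<Rightarrow> real \<Rightarrow> 'a l2 set" where
  "Hdot D \<alpha> = dom_laplacian_pow D (\<alpha> / 2)"

definition norm_HH :: "'a::euclidean_space set \<Rightarrow> real \<Rightarrow> 'a l2 \<times> 'a l2 \<Rightarrow> real" where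
  "norm_HH D \<alpha> = (\<lambda>(u, v). sqrt ((norm (laplacian_pow D (\<alpha> / 2) u))\<^sup>2 +
     (norm (laplacian_pow D ((\<alpha> - 1) / 2) v))\<^sup>2))"


section \<open>Operators and noise\<close>

text \<open>Operators on \<^term>\<open>L2 D\<close> are maps on the ambient space of which only the values on
  \<^term>\<open>L2 D\<close> matter.\<close>

definition bounded_op :: "'a::euclidean_space set \<Rightarrow> ('a l2 \<Rightarrow> 'a l2) \<Rightarrow> bool" where
  "bounded_op D A \<longleftrightarrow>
     (\<forall>u\<in>L2 D. A u \<in> L2 D) \<and>
     (\<forall>u\<in>L2 D. \<forall>v\<in>L2 D. A (u + v) = A u + A v) \<and>
     (\<forall>r. \<forall>u\<in>L2 D. A (r *\<^sub>R u) = r *\<^sub>R A u) \<and>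
     (\<exists>K. \<forall>u\<in>L2 D. norm (A u) \<le> K * norm u)"

definition selfadjoint_psd :: "'a::euclidean_space set \<Rightarrow> ('a l2 \<Rightarrow> 'a l2) \<Rightarrow> bool" where
  "selfadjoint_psd D A \<longleftrightarrow> bounded_op D A \<and>
     (\<forall>u\<in>L2 D. \<forall>v\<in>L2 D. inner (A u) v = inner u (A v)) \<and>
     (\<forall>u\<in>L2 D. 0 \<le> inner (A u) u)"

text \<open>The positive semi-definite square root; its values on \<^term>\<open>L2 D\<close> are unique.\<close>

definition op_sqrt :: "'a::euclidean_space set \<Rightarrow> ('a l2 \<Rightarrow> 'a l2) \<Rightarrow> 'a l2 \<Rightarrow> 'a l2" where
  "op_sqrt D Q = (SOME R. selfadjoint_psd D R \<and> (\<forall>u\<in>L2 D. R (R u) = Q u))"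

definition orthonormal_basis :: "'a::euclidean_space set \<Rightarrow> 'a l2 set \<Rightarrow> bool" where
  "orthonormal_basis D B \<longleftrightarrow> B \<subseteq> L2 D \<and> pairwise (\<lambda>u v. inner u v = 0) B \<and>
     (\<forall>b\<in>B. norm b = 1) \<and> closure (span B) = L2 D"

text \<open>The sum is the squared Hilbert-Schmidt norm and does not depend on the basis.\<close>

definition hilbert_schmidt :: "'a::euclidean_space set \<Rightarrow> ('a l2 \<Rightarrow> 'a l2) \<Rightarrow> bool" where
  "hilbert_schmidt D A \<longleftrightarrow> bounded_op D A \<and>
     (\<exists>B. orthonormal_basis D B \<and> (\<lambda>b. (norm (A b))\<^sup>2) summable_on B)"

definition normal_filtration ::
  "'w measure \<Rightarrow> (real \<Rightarrow> 'w measure) \<Rightarrow> real \<Rightarrow> bool" where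
  "normal_filtration M F T \<longleftrightarrow>
     (\<forall>t\<in>{0..T}. subalgebra M (F t)) \<and>
     (\<forall>s t. 0 \<le> s \<and> s \<le> t \<and> t \<le> T \<longrightarrow> sets (F s) \<subseteq> sets (F t)) \<and>
     null_sets M \<subseteq> sets (F 0) \<and>
     (\<forall>t. 0 \<le> t \<and> t < T \<longrightarrow> sets (F t) = (\<Inter>s\<in>{t<..T}. sets (F s)))"

definition centered_gaussian :: "'w measure \<Rightarrow> ('w \<Rightarrow> real) \<Rightarrow> real \<Rightarrow> bool" where
  "centered_gaussian M X \<sigma>2 \<longleftrightarrow> (if \<sigma>2 = 0 then AE \<omega> in M. X \<omega> = 0
     else distributed M lborel X (\<lambda>x. ennreal (normal_density 0 (sqrt \<sigma>2) x)))"

text \<open>The law of a Hilbert space valued increment is the centered Gaussian measure with covariance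
  \<open>(t - s) Q\<close> iff all of its one-dimensional projections are centered Gaussian with the
  corresponding variance.\<close>

definition Q_Wiener_process ::
  "'w measure \<Rightarrow> (real \<Rightarrow> 'w measure) \<Rightarrow> real \<Rightarrow> 'a::euclidean_space set \<Rightarrow>
   ('a l2 \<Rightarrow> 'a l2) \<Rightarrow> (real \<Rightarrow> 'w \<Rightarrow> 'a l2) \<Rightarrow> bool" where
  "Q_Wiener_process M F T D Q W \<longleftrightarrow>
     (\<forall>t\<in>{0..T}. W t \<in> borel_measurable (F t) \<and> (\<forall>\<omega>\<in>space M. W t \<omega> \<in> L2 D)) \<and>
     (AE \<omega> in M. W 0 \<omega> = 0) \<and>
     (AE \<omega> in M. continuous_on {0..T} (\<lambda>t. W t \<omega>)) \<and>
     (\<forall>s t. 0 \<le> s \<and> s < t \<and> t \<le> T \<longrightarrow>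
        prob_space.indep_set M (sets (F s))
          (sets (vimage_algebra (space M) (\<lambda>\<omega>. W t \<omega> - W s \<omega>) borel)) \<and>
        (\<forall>\<phi>\<in>L2 D. centered_gaussian M (\<lambda>\<omega>. inner (W t \<omega> - W s \<omega>) \<phi>)
           ((t - s) * inner (Q \<phi>) \<phi>)))"


section \<open>Nonlinearity and energy\<close>

text \<open>For a cubic \<^term>\<open>f\<close> and \<open>u, v \<in> L\<^sup>2(D)\<close> the integrand is of fourth order, so the integral need not be
  finite. For positive leading coefficient, which the growth condition on \<^term>\<open>F\<close> forces, it then
  equals \<open>+\<infinity>\<close> and the one-sided Lipschitz bound holds trivially.\<close>

definition admissible_nonlinearity ::
  "'a::euclidean_space set \<Rightarrow> real poly \<Rightarrow> real poly \<Rightarrow>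
   real \<Rightarrow> real \<Rightarrow> real \<Rightarrow> real \<Rightarrow> real \<Rightarrow> bool" where
  "admissible_nonlinearity D f F a1 a2 b1 b2 c \<longleftrightarrow>
     degree f = 3 \<and> pderiv F = f \<and> 0 < a1 \<and> 0 < a2 \<and> 0 < b1 \<and> 0 < b2 \<and> 0 < c \<and>
     (\<forall>u \<in> borel_measurable borel. set_integrable lborel D (\<lambda>x. \<bar>u x\<bar> ^ 4) \<longrightarrow>
        a1 * (LINT x:D|lborel. \<bar>u x\<bar> ^ 4) - b1 \<le> (LINT x:D|lborel. poly F (u x)) \<and>
        (LINT x:D|lborel. poly F (u x)) \<le> a2 * (LINT x:D|lborel. \<bar>u x\<bar> ^ 4) - b2) \<and>
     (\<forall>u\<in>L2 D. \<forall>v\<in>L2 D.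
        set_integrable lborel D
          (\<lambda>x. (poly f (rep_l2 u x) - poly f (rep_l2 v x)) * (rep_l2 u x - rep_l2 v x)) \<longrightarrow>
        - (LINT x:D|lborel.
             (poly f (rep_l2 u x) - poly f (rep_l2 v x)) * (rep_l2 u x - rep_l2 v x))
          \<le> c * (norm (u - v))\<^sup>2)"

definition energy ::
  "'a::euclidean_space set \<Rightarrow> real poly \<Rightarrow> real \<Rightarrow> 'a l2 \<Rightarrow> 'a l2 \<Rightarrow> real" where
  "energy D F C1 u v = 1/2 * grad_inner D u u + 1/2 * (norm v)\<^sup>2 +
     (LINT x:D|lborel. poly F (rep_l2 u x)) + C1"


section \<open>The fully discrete scheme\<close>

definition laplacian_h :: "'a::euclidean_space set \<Rightarrow> 'a l2 set \<Rightarrow> 'a l2 \<Rightarrow> 'a l2" where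
  "laplacian_h D Vh v = riesz Vh (grad_inner D v)"

definition fun_h ::
  "'a::euclidean_space set \<Rightarrow> 'a l2 set \<Rightarrow> (real \<Rightarrow> real) \<Rightarrow> 'a l2 \<Rightarrow> 'a l2" where
  "fun_h D Vh = spectral_fun Vh (laplacian_h D Vh)"

definition pow_h :: "'a::euclidean_space set \<Rightarrow> 'a l2 set \<Rightarrow> real \<Rightarrow> 'a l2 \<Rightarrow> 'a l2" where
  "pow_h D Vh s = fun_h D Vh (\<lambda>\<mu>. \<mu> powr s)"

definition C_h :: "'a::euclidean_space set \<Rightarrow> 'a l2 set \<Rightarrow> real \<Rightarrow> 'a l2 \<Rightarrow> 'a l2" where
  "C_h D Vh \<tau> = fun_h D Vh (\<lambda>\<mu>. cos (\<tau> * \<mu> powr (1/2)))"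

definition S_h :: "'a::euclidean_space set \<Rightarrow> 'a l2 set \<Rightarrow> real \<Rightarrow> 'a l2 \<Rightarrow> 'a l2" where
  "S_h D Vh \<tau> = fun_h D Vh (\<lambda>\<mu>. sin (\<tau> * \<mu> powr (1/2)))"

text \<open>The projection onto \<open>V\<^sub>h\<close> acts on the dual space of \<open>H\<^sub>0\<^sup>1(D)\<close>, i.e. on functionals. An element
  \<open>u\<close> of \<open>L\<^sup>2(D)\<close> is the functional \<^term>\<open>inner u\<close>, a function \<open>g\<close> that need not be
  square-integrable is the functional \<open>pairing D g\<close>.\<close>

definition P_h :: "'a::euclidean_space l2 set \<Rightarrow> ('a l2 \<Rightarrow> real) \<Rightarrow> 'a l2" where
  "P_h Vh l = riesz Vh l"

definition pairing :: "'a::euclidean_space set \<Rightarrow> ('a \<Rightarrow> real) \<Rightarrow> 'a l2 \<Rightarrow> real" where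
  "pairing D g \<psi> = (LINT x:D|lborel. g x * rep_l2 \<psi> x)"

definition averaged_f ::
  "real poly \<Rightarrow> 'a::euclidean_space l2 \<Rightarrow> 'a l2 \<Rightarrow> 'a \<Rightarrow> real" where
  "averaged_f f u u' x =
     integral {0..1} (\<lambda>\<theta>. poly f (rep_l2 u x + \<theta> * (rep_l2 u' x - rep_l2 u x)))"

definition scheme_step ::
  "'a::euclidean_space set \<Rightarrow> 'a l2 set \<Rightarrow> real poly \<Rightarrow> real \<Rightarrow> 'a l2 \<Rightarrow>
   'a l2 \<Rightarrow> 'a l2 \<Rightarrow> 'a l2 \<Rightarrow> 'a l2 \<Rightarrow> bool" where
  "scheme_step D Vh f \<tau> dw u v u' v' \<longleftrightarrow>
     (let G = P_h Vh (pairing D (averaged_f f u u')) in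
       u' = C_h D Vh \<tau> u + pow_h D Vh (-1/2) (S_h D Vh \<tau> v)
              - pow_h D Vh (-1) (G - C_h D Vh \<tau> G) \<and>
       v' = - pow_h D Vh (1/2) (S_h D Vh \<tau> u) + C_h D Vh \<tau> v
              - pow_h D Vh (-1/2) (S_h D Vh \<tau> G) + P_h Vh (inner dw))"

end

theory Submission
  imports Defs "HOL-Real_Asymp.Real_Asymp"
begin

text \<open>
  The energy identity is pathwise and concerns a single step; the noise increment enters the scheme
  additively and is removed again in \<open>Vbar\<close>.

  In an \<open>L\<^sup>2\<close>-orthonormal basis of eigenvectors of the discrete Laplacian the step decouples. With the
  averaged nonlinearity \<open>G = P\<^sub>h \<integral>\<^sub>0\<^sup>1 f(U + \<theta>(U' - U)) d\<theta>\<close> regarded as a constant force, each mode moves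
  by the exact flow of an oscillator, that is, by a rotation about a shifted equilibrium. The rotation
  preserves the energy of the oscillator, which says that \<open>1/2 \<parallel>\<nabla>U\<parallel>\<^sup>2 + 1/2 \<parallel>V\<parallel>\<^sup>2\<close> changes by
  \<open>- \<langle>G, U' - U\<rangle>\<close> (\<open>mode_energy\<close>). By the fundamental theorem of calculus along the segment from \<open>U\<close> to
  \<open>U'\<close>, the pairing \<open>\<langle>G, U' - U\<rangle>\<close> equals the increment of \<open>\<integral> F(U)\<close> (\<open>pairing_averaged_f_diff\<close>), so the
  total energy is unchanged (\<open>scheme_step_energy\<close>).

  Three facts make this computation legitimate.

  First, the discrete Laplacian must be a linear symmetric operator. Its form is built from weak
  derivatives, which are given by a definite description, so one needs that weak derivatives are
  unique: a square-integrable function orthogonal to all test functions vanishes in \<open>D\<close>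
  (\<open>AE_zero_if_test_integrals_zero\<close>). The test functions used for this are explicit smooth bumps that
  converge to indicators of boxes.

  Second, \<open>F(U)\<close> and the pairing with \<open>G\<close> are integrals of fourth order. They are finite because
  elements of \<open>H\<^sub>0\<^sup>1\<close> lie in \<open>L\<^sup>4\<close> in dimensions one and two (\<open>H01_L4\<close>), which is where the dimension
  enters. The embedding is Ladyzhenskaya's inequality for test functions followed by Fatou's lemma.

  Third, symmetric operators on a finite-dimensional subspace of an infinite-dimensional inner product
  space have an orthonormal eigenbasis (\<open>orthonormal_eigenbasis_exists\<close>), in which functions of the
  operator act coordinatewise (\<open>spectral_fun_eigenbasis\<close>).
\<close>


section \<open>Representatives of square-integrable classes\<close>

lemma sq_integrable_rep_l2: "sq_integrable (rep_l2 u)"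
  using Quotient_rep_reflp[OF Quotient_l2] by (auto simp: l2rel_def)

lemma borel_measurable_rep_l2 [measurable]: "rep_l2 u \<in> borel_measurable borel"
  using sq_integrable_rep_l2[of u] by (simp add: sq_integrable_def)

lemma abs_rep_l2 [simp]: "abs_l2 (rep_l2 u) = u"
  by (rule Quotient_abs_rep[OF Quotient_l2])

lemma rep_abs_l2:
  assumes "sq_integrable f"
  shows "AE x in lborel. rep_l2 (abs_l2 f) x = f x"
proof -
  have "l2rel f f" using assms by (simp add: l2rel_def)
  then have "l2rel (rep_l2 (abs_l2 f)) f"
    by (rule Quotient_rep_abs[OF Quotient_l2])
  then show ?thesis by (simp add: l2rel_def)
qed

lemma inner_l2_eq: "inner u v = (\<integral>x. rep_l2 u x * rep_l2 v x \<partial>lborel)"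
  by (simp add: inner_l2_def)

lemma plus_l2_eq: "u + v = abs_l2 (\<lambda>x. rep_l2 u x + rep_l2 v x)"
  by (simp add: plus_l2_def)

lemma scaleR_l2_eq: "r *\<^sub>R u = abs_l2 (\<lambda>x. r * rep_l2 u x)"
  by (simp add: scaleR_l2_def)

lemma rep_l2_add: "AE x in lborel. rep_l2 (u + v) x = rep_l2 u x + rep_l2 v x"
  unfolding plus_l2_eq by (intro rep_abs_l2 sq_integrable_add sq_integrable_rep_l2)

lemma rep_l2_scaleR: "AE x in lborel. rep_l2 (r *\<^sub>R u) x = r * rep_l2 u x"
  unfolding scaleR_l2_eq by (intro rep_abs_l2 sq_integrable_scale sq_integrable_rep_l2)

lemma rep_l2_zero: "AE x in lborel. rep_l2 (0 :: 'a::euclidean_space l2) x = 0"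
proof -
  have "rep_l2 (0 :: 'a l2) = rep_l2 (0 *\<^sub>R 0)" by simp
  then show ?thesis using rep_l2_scaleR[of 0 "0 :: 'a l2"] by simp
qed

lemma rep_l2_diff: "AE x in lborel. rep_l2 (u - v) x = rep_l2 u x - rep_l2 v x"
proof -
  have "u - v = u + (-1) *\<^sub>R v" by simp
  moreover have "AE x in lborel. rep_l2 (u + (-1) *\<^sub>R v) x = rep_l2 u x + rep_l2 ((-1) *\<^sub>R v) x"
    by (rule rep_l2_add)
  moreover have "AE x in lborel. rep_l2 ((-1) *\<^sub>R v) x = (-1) * rep_l2 v x"
    by (rule rep_l2_scaleR)
  ultimately show ?thesis by (auto elim!: eventually_elim2)
qed

lemma l2_eqI:
  assumes "AE x in lborel. rep_l2 u x = rep_l2 v x"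
  shows "u = v"
proof -
  have "l2rel (rep_l2 u) (rep_l2 v)"
    using assms by (simp add: l2rel_def sq_integrable_rep_l2)
  then show ?thesis
    using Quotient_rel_abs[OF Quotient_l2] by fastforce
qed

lemma inner_abs_l2:
  assumes "sq_integrable f"
  shows "inner u (abs_l2 f) = (\<integral>x. rep_l2 u x * f x \<partial>lborel)"
  unfolding inner_l2_eq
proof (rule integral_cong_AE)
  show "AE x in lborel. rep_l2 u x * rep_l2 (abs_l2 f) x = rep_l2 u x * f x"
    using rep_abs_l2[OF assms] by eventually_elim simp
qed (use assms in \<open>auto simp: sq_integrable_def\<close>)

lemma norm_abs_l2:
  assumes "sq_integrable f"
  shows "(norm (abs_l2 f))\<^sup>2 = (\<integral>x. (f x)\<^sup>2 \<partial>lborel)"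
proof -
  have "(norm (abs_l2 f))\<^sup>2 = (\<integral>x. rep_l2 (abs_l2 f) x * f x \<partial>lborel)"
    by (simp add: power2_norm_eq_inner inner_abs_l2[OF assms])
  also have "\<dots> = (\<integral>x. (f x)\<^sup>2 \<partial>lborel)"
  proof (rule integral_cong_AE)
    show "AE x in lborel. rep_l2 (abs_l2 f) x * f x = (f x)\<^sup>2"
      using rep_abs_l2[OF assms] by eventually_elim (simp add: power2_eq_square)
  qed (use assms in \<open>auto simp: sq_integrable_def\<close>)
  finally show ?thesis .
qed

lemma L2_diff:
  assumes "u \<in> L2 D" "v \<in> L2 D"
  shows "u - v \<in> L2 D"
proof -
  have "AE x in lborel. x \<notin> D \<longrightarrow> rep_l2 u x = 0" "AE x in lborel. x \<notin> D \<longrightarrow> rep_l2 v x = 0"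
    using assms by (auto simp: L2_def)
  with rep_l2_diff[of u v] have "AE x in lborel. x \<notin> D \<longrightarrow> rep_l2 (u - v) x = 0"
    by eventually_elim auto
  then show ?thesis by (simp add: L2_def)
qed

lemma L2_add:
  assumes "u \<in> L2 D" "v \<in> L2 D"
  shows "u + v \<in> L2 D"
proof -
  have "AE x in lborel. x \<notin> D \<longrightarrow> rep_l2 u x = 0" "AE x in lborel. x \<notin> D \<longrightarrow> rep_l2 v x = 0"
    using assms by (auto simp: L2_def)
  with rep_l2_add[of u v] have "AE x in lborel. x \<notin> D \<longrightarrow> rep_l2 (u + v) x = 0"
    by eventually_elim auto
  then show ?thesis by (simp add: L2_def)
qed

lemma L2_scaleR:
  assumes "u \<in> L2 D"
  shows "r *\<^sub>R u \<in> L2 D"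
proof -
  have "AE x in lborel. x \<notin> D \<longrightarrow> rep_l2 u x = 0"
    using assms by (auto simp: L2_def)
  with rep_l2_scaleR[of r u] have "AE x in lborel. x \<notin> D \<longrightarrow> rep_l2 (r *\<^sub>R u) x = 0"
    by eventually_elim auto
  then show ?thesis by (simp add: L2_def)
qed


section \<open>Smooth bump functions\<close>

lemma C_k_antimono: "C_k (Suc k) f \<Longrightarrow> C_k k f"
proof (induction k arbitrary: f)
  case 0
  then show ?case
    by (auto simp: continuous_on_eq_continuous_within intro: differentiable_imp_continuous_within)
qed auto

lemma pderivative_eq:
  assumes "(f has_derivative f') (at x)"
  shows "pderivative i f x = f' i"
  unfolding pderivative_def using frechet_derivative_at[OF assms] by simp

lemma C_k_const: "C_k k (\<lambda>_. c)"
proof (induction k arbitrary: c)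
  case (Suc k)
  have "pderivative i (\<lambda>_ :: 'a. c) = (\<lambda>_. 0)" for i
    by (auto simp: pderivative_def)
  then show ?case using Suc by simp
qed simp

lemma C_k_add: "C_k k f \<Longrightarrow> C_k k g \<Longrightarrow> C_k k (\<lambda>x. f x + g x)"
proof (induction k arbitrary: f g)
  case 0
  then show ?case by (simp add: continuous_on_add)
next
  case (Suc k)
  have "pderivative i (\<lambda>x. f x + g x) = (\<lambda>x. pderivative i f x + pderivative i g x)" for i
  proof
    fix x
    have "((\<lambda>x. f x + g x) has_derivative
        (\<lambda>h. frechet_derivative f (at x) h + frechet_derivative g (at x) h)) (at x)"
      using Suc.prems by (intro has_derivative_add) (auto simp: frechet_derivative_works[symmetric])
    then show "pderivative i (\<lambda>x. f x + g x) x = pderivative i f x + pderivative i g x"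
      by (simp add: pderivative_eq pderivative_def[of i f] pderivative_def[of i g])
  qed
  then show ?case using Suc by simp
qed

lemma C_k_mult: "C_k k f \<Longrightarrow> C_k k g \<Longrightarrow> C_k k (\<lambda>x. f x * g x)"
proof (induction k arbitrary: f g)
  case 0
  then show ?case by (simp add: continuous_on_mult)
next
  case (Suc k)
  have "pderivative i (\<lambda>x. f x * g x) = (\<lambda>x. f x * pderivative i g x + pderivative i f x * g x)" for i
  proof
    fix x
    have "((\<lambda>x. f x * g x) has_derivative
        (\<lambda>h. f x * frechet_derivative g (at x) h + frechet_derivative f (at x) h * g x)) (at x)"
      using Suc.prems by (intro has_derivative_mult) (auto simp: frechet_derivative_works[symmetric])
    then show "pderivative i (\<lambda>x. f x * g x) x = f x * pderivative i g x + pderivative i f x * g x"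
      by (simp add: pderivative_eq pderivative_def[of i f] pderivative_def[of i g])
  qed
  moreover have "C_k k f" "C_k k g" using Suc.prems C_k_antimono by blast+
  ultimately show ?case using Suc by (auto intro!: C_k_add)
qed

lemma C_k_prod:
  assumes "finite I" "\<And>i. i \<in> I \<Longrightarrow> C_k k (f i)"
  shows "C_k k (\<lambda>x. \<Prod>i\<in>I. f i x)"
  using assms by (induction rule: finite_induct) (auto simp: C_k_const C_k_mult)

text \<open>For \<open>p = 1\<close> this is the standard smooth function that vanishes on the negative half-line; the
  polynomial factor accommodates its derivatives.\<close>

definition flat :: "real poly \<Rightarrow> real \<Rightarrow> real" where
  "flat p x = (if 0 < x then poly p (1 / x) * exp (- (1 / x)) else 0)"

lemma flat_tendsto_0: "(flat p \<longlongrightarrow> 0) (at 0)"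
proof -
  have "((\<lambda>y. \<Sum>i\<le>degree p. coeff p i * (y ^ i / exp y)) \<longlongrightarrow> (\<Sum>i\<le>degree p. coeff p i * 0)) at_top"
    by (intro tendsto_intros tendsto_power_div_exp_0)
  then have "((\<lambda>y. poly p y * exp (- y)) \<longlongrightarrow> 0) at_top"
    by (simp add: poly_altdef sum_distrib_right exp_minus divide_inverse mult.assoc)
  then have "((\<lambda>x. poly p (inverse x) * exp (- inverse x)) \<longlongrightarrow> 0) (at_right 0)"
    by (rule filterlim_compose) (rule filterlim_inverse_at_top_right)
  then have "(flat p \<longlongrightarrow> 0) (at_right 0)"
    by (rule Lim_transform_eventually)
       (auto simp: flat_def eventually_at_filter inverse_eq_divide)
  moreover have "(flat p \<longlongrightarrow> 0) (at_left 0)"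
    by (rule Lim_transform_eventually[OF tendsto_const])
       (auto simp: flat_def eventually_at_filter)
  ultimately show ?thesis by (rule filterlim_split_at_real[rotated])
qed

text \<open>The functions \<open>p(1/x) exp(-1/x)\<close> on the positive half-line, extended by zero, are closed under
  differentiation, also at the origin: the difference quotient there is again such a function and
  tends to zero. Hence they are smooth.\<close>

lemma DERIV_flat: "(flat p has_real_derivative flat (monom 1 2 * (p - pderiv p)) x) (at x)"
proof (cases "x = 0")
  case True
  have "((\<lambda>h. flat (pCons 0 p) h) \<longlongrightarrow> 0) (at 0)" by (rule flat_tendsto_0)
  moreover have "flat (pCons 0 p) = (\<lambda>h. (flat p (0 + h) - flat p 0) / h)"
    by (auto simp: flat_def fun_eq_iff)
  ultimately have "(flat p has_real_derivative 0) (at 0)"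
    unfolding DERIV_def by simp
  then show ?thesis unfolding True by (simp add: flat_def)
next
  case False
  then consider "x < 0" | "0 < x" by linarith
  then show ?thesis
  proof cases
    case 1
    have "((\<lambda>_. 0) has_real_derivative 0) (at x)" by simp
    then have "(flat p has_real_derivative 0) (at x)"
      by (rule has_field_derivative_transform_within_open[of _ _ _ "{..<0}"])
         (use 1 in \<open>auto simp: flat_def\<close>)
    then show ?thesis using 1 by (simp add: flat_def)
  next
    case 2
    have "((\<lambda>x. poly p (1 / x) * exp (- (1 / x))) has_real_derivative
        poly (pderiv p) (1 / x) * (- (1 / x\<^sup>2)) * exp (- (1 / x))
        + exp (- (1 / x)) * (1 / x\<^sup>2) * poly p (1 / x)) (at x)"
      using 2 by (auto intro!: derivative_eq_intros DERIV_chain2[OF poly_DERIV] simp: power2_eq_square)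
    moreover have "poly (pderiv p) (1 / x) * (- (1 / x\<^sup>2)) * exp (- (1 / x))
        + exp (- (1 / x)) * (1 / x\<^sup>2) * poly p (1 / x) = flat (monom 1 2 * (p - pderiv p)) x"
      using 2 by (simp add: flat_def poly_monom algebra_simps power_divide)
    ultimately have "((\<lambda>x. poly p (1 / x) * exp (- (1 / x))) has_real_derivative
        flat (monom 1 2 * (p - pderiv p)) x) (at x)" by simp
    then show ?thesis
      by (rule has_field_derivative_transform_within_open[of _ _ _ "{0<..}"])
         (use 2 in \<open>auto simp: flat_def\<close>)
  qed
qed

lemma C_k_flat: "C_k k (\<lambda>x :: 'a::euclidean_space. flat p (\<alpha> * inner x i + \<beta>))"
proof -
  have der: "((\<lambda>x :: 'a. flat p (\<alpha> * inner x i + \<beta>)) has_derivative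
      (\<lambda>h. flat (monom 1 2 * (p - pderiv p)) (\<alpha> * inner x i + \<beta>) * (\<alpha> * inner h i))) (at x)" for p x
    by (rule has_derivative_compose[OF _ DERIV_flat[unfolded has_field_derivative_def]])
       (auto intro!: derivative_eq_intros)
  show ?thesis
  proof (induction k arbitrary: p)
    case 0
    have "continuous (at x) (\<lambda>x :: 'a. flat p (\<alpha> * inner x i + \<beta>))" for x
      using has_derivative_continuous[OF der] .
    then show ?case by (simp add: continuous_at_imp_continuous_on)
  next
    case (Suc k)
    have "pderivative j (\<lambda>x :: 'a. flat p (\<alpha> * inner x i + \<beta>)) =
        (\<lambda>x. flat (monom 1 2 * (p - pderiv p)) (\<alpha> * inner x i + \<beta>) * (\<alpha> * inner j i))" for j
      using pderivative_eq[OF der] by auto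
    moreover have "(\<lambda>x :: 'a. flat p (\<alpha> * inner x i + \<beta>)) differentiable (at x)" for x
      using der differentiableI by blast
    ultimately show ?case using Suc by (auto intro!: C_k_mult C_k_const)
  qed
qed

lemma flat_1_bounds: "0 \<le> flat 1 x" "flat 1 x \<le> 1"
  by (auto simp: flat_def)

lemma flat_1_tendsto:
  assumes "0 < y"
  shows "(\<lambda>n. flat 1 (real n * y - 1)) \<longlonglongrightarrow> 1"
proof -
  have lim: "filterlim (\<lambda>n. real n * y - 1) at_top sequentially"
    using assms by real_asymp
  have "((\<lambda>z::real. exp (- (1 / z))) \<longlongrightarrow> 1) at_top" by real_asymp
  from filterlim_compose[OF this lim]
  have "(\<lambda>n. exp (- (1 / (real n * y - 1)))) \<longlonglongrightarrow> 1" .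
  moreover have "\<forall>\<^sub>F n in sequentially. 0 < real n * y - 1"
    using lim unfolding filterlim_at_top_dense by blast
  then have "\<forall>\<^sub>F n in sequentially. exp (- (1 / (real n * y - 1))) = flat 1 (real n * y - 1)"
    by eventually_elim (simp add: flat_def)
  ultimately show ?thesis by (rule Lim_transform_eventually)
qed

text \<open>The \<open>n\<close>-th function is supported at distance \<open>1/n\<close> from the boundary of the box, so its support
  is a compact subset of the open box.\<close>

definition box_bump :: "'a::euclidean_space \<Rightarrow> 'a \<Rightarrow> nat \<Rightarrow> 'a \<Rightarrow> real" where
  "box_bump a b n x = (\<Prod>i\<in>Basis. flat 1 (real n * (inner x i - inner a i) - 1) *
     flat 1 (real n * (inner b i - inner x i) - 1))"

lemma box_bump_bounds: "0 \<le> box_bump a b n x" "box_bump a b n x \<le> 1"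
  unfolding box_bump_def
  by (intro prod_nonneg ballI mult_nonneg_nonneg flat_1_bounds)
     (intro prod_le_1 conjI mult_nonneg_nonneg mult_le_one flat_1_bounds)

lemma box_bump_tendsto: "(\<lambda>n. box_bump a b n x) \<longlonglongrightarrow> indicator (box a b) x"
proof (cases "x \<in> box a b")
  case True
  then have "(\<lambda>n. box_bump a b n x) \<longlonglongrightarrow> (\<Prod>i\<in>(Basis :: 'a set). 1 * 1)"
    unfolding box_bump_def by (intro tendsto_intros flat_1_tendsto) (auto simp: box_def)
  then show ?thesis using True by simp
next
  case False
  then obtain i where i: "i \<in> Basis" "inner x i \<le> inner a i \<or> inner b i \<le> inner x i"
    by (auto simp: box_def not_less)
  have "flat 1 (real n * (inner x i - inner a i) - 1) * flat 1 (real n * (inner b i - inner x i) - 1) = 0" for n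
    using i(2) mult_nonneg_nonpos[of "real n" "inner x i - inner a i"]
      mult_nonneg_nonpos[of "real n" "inner b i - inner x i"]
    by (auto simp: flat_def)
  then have "box_bump a b n x = 0" for n
    unfolding box_bump_def using i(1) by (auto intro!: prod_zero)
  then show ?thesis using False by simp
qed

lemma box_bump_test_function:
  assumes "box a b \<subseteq> D" "1 \<le> n"
  shows "box_bump a b n \<in> test_functions D"
proof -
  let ?a = "a + (1 / real n) *\<^sub>R One" and ?b = "b - (1 / real n) *\<^sub>R One"
  have "{x. box_bump a b n x \<noteq> 0} \<subseteq> cbox ?a ?b"
  proof
    fix x assume "x \<in> {x. box_bump a b n x \<noteq> 0}"
    then have nz: "flat 1 (real n * (inner x i - inner a i) - 1) \<noteq> 0"
      "flat 1 (real n * (inner b i - inner x i) - 1) \<noteq> 0" if "i \<in> Basis" for i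
      using that by (auto simp: box_bump_def)
    have "inner ?a i \<le> inner x i \<and> inner x i \<le> inner ?b i" if i: "i \<in> Basis" for i
    proof -
      have "1 < real n * (inner x i - inner a i)" "1 < real n * (inner b i - inner x i)"
        using nz[OF i] by (auto simp: flat_def split: if_splits)
      then have "1 / real n < inner x i - inner a i" "1 / real n < inner b i - inner x i"
        using assms(2) by (simp_all add: divide_less_eq mult.commute)
      then show ?thesis using i by (simp add: inner_add_left inner_diff_left)
    qed
    then show "x \<in> cbox ?a ?b" by (auto simp: mem_box)
  qed
  then have supp: "closure {x. box_bump a b n x \<noteq> 0} \<subseteq> cbox ?a ?b"
    by (intro closure_minimal) auto
  then have "compact (closure {x. box_bump a b n x \<noteq> 0})"
    using bounded_subset[OF bounded_cbox] by (metis closed_closure compact_eq_bounded_closed)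
  moreover have "cbox ?a ?b \<subseteq> box a b"
  proof
    fix x assume x: "x \<in> cbox ?a ?b"
    have "inner a i < inner x i \<and> inner x i < inner b i" if i: "i \<in> Basis" for i
    proof -
      have "0 < 1 / real n" using assms(2) by simp
      moreover have "inner ?a i \<le> inner x i" "inner x i \<le> inner ?b i"
        using x i by (auto simp: mem_box)
      moreover have "inner ?a i = inner a i + 1 / real n" "inner ?b i = inner b i - 1 / real n"
        using i by (simp_all add: inner_add_left inner_diff_left)
      ultimately show ?thesis by linarith
    qed
    then show "x \<in> box a b" by (simp add: mem_box)
  qed
  then have "closure {x. box_bump a b n x \<noteq> 0} \<subseteq> D" using supp assms(1) by blast
  moreover have "C_k k (box_bump a b n)" for k
  proof -
    have "box_bump a b n = (\<lambda>x. \<Prod>i\<in>Basis. flat 1 (real n * inner x i + (- real n * inner a i - 1)) *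
        flat 1 ((- real n) * inner x i + (real n * inner b i - 1)))"
      unfolding box_bump_def[abs_def]
      by (intro ext prod.cong arg_cong2[where f = times] arg_cong[where f = "flat 1"] refl)
         (simp_all add: algebra_simps)
    moreover have "C_k k (\<lambda>x. \<Prod>i\<in>Basis. flat 1 (real n * inner x i + (- real n * inner a i - 1)) *
        flat 1 ((- real n) * inner x i + (real n * inner b i - 1)))"
      by (intro C_k_prod C_k_mult C_k_flat) simp
    ultimately show ?thesis by simp
  qed
  ultimately show ?thesis by (simp add: test_functions_def)
qed

lemma sq_integrable_compact_support:
  fixes \<phi> :: "'a::euclidean_space \<Rightarrow> real"
  assumes "continuous_on UNIV \<phi>" "compact S" "\<And>x. x \<notin> S \<Longrightarrow> \<phi> x = 0"
  shows "sq_integrable \<phi>"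
proof -
  have "integrable lborel (\<lambda>x. indicator S x *\<^sub>R (\<phi> x)\<^sup>2)"
    using assms(1,2)
    by (intro borel_integrable_compact continuous_intros) (auto intro: continuous_on_subset)
  moreover have "(\<lambda>x. indicator S x *\<^sub>R (\<phi> x)\<^sup>2) = (\<lambda>x. (\<phi> x)\<^sup>2)"
    using assms(3) by (auto simp: indicator_def fun_eq_iff)
  moreover have "\<phi> \<in> borel_measurable borel"
    using assms(1) by (rule borel_measurable_continuous_onI)
  ultimately show ?thesis by (simp add: sq_integrable_def)
qed

lemma test_function_continuous: "\<phi> \<in> test_functions D \<Longrightarrow> continuous_on UNIV \<phi>"
  unfolding test_functions_def using C_k.simps(1) by blast

lemma test_function_sq_integrable: "\<phi> \<in> test_functions D \<Longrightarrow> sq_integrable \<phi>"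
  by (rule sq_integrable_compact_support[OF test_function_continuous, of _ _ "closure {x. \<phi> x \<noteq> 0}"])
     (auto simp: test_functions_def intro: closure_subset[THEN subsetD])

lemma test_function_has_derivative:
  "\<phi> \<in> test_functions D \<Longrightarrow> (\<phi> has_derivative frechet_derivative \<phi> (at x)) (at x)"
  using C_k.simps(2)[of 0 \<phi>]
  by (simp add: test_functions_def frechet_derivative_works[symmetric] del: C_k.simps)

lemma test_function_pderivative:
  assumes \<phi>: "\<phi> \<in> test_functions D" and i: "i \<in> Basis"
  shows "continuous_on UNIV (pderivative i \<phi>)" "sq_integrable (pderivative i \<phi>)"
proof -
  let ?S = "closure {x. \<phi> x \<noteq> 0}"
  have "C_k (Suc 0) \<phi>" using \<phi> unfolding test_functions_def by blast
  then show cont: "continuous_on UNIV (pderivative i \<phi>)" using i by simp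
  have "pderivative i \<phi> x = 0" if "x \<notin> ?S" for x
  proof -
    have "((\<lambda>_. 0) has_derivative (\<lambda>_. 0)) (at x)" by simp
    then have "(\<phi> has_derivative (\<lambda>_. 0)) (at x)"
      by (rule has_derivative_transform_within_open[of _ _ _ _ "- ?S"])
         (use that in \<open>auto intro: closure_subset[THEN subsetD]\<close>)
    then show ?thesis by (rule pderivative_eq)
  qed
  moreover have "compact ?S" using \<phi> by (simp add: test_functions_def)
  ultimately show "sq_integrable (pderivative i \<phi>)"
    using cont sq_integrable_compact_support by blast
qed


section \<open>Weak partial derivatives\<close>

text \<open>The positive and the negative part of \<open>g\<close> are densities of finite measures that agree on boxes.
  Boxes are closed under intersection and generate the Borel sets, so the measures and hence the
  densities agree.\<close>

lemma AE_zero_if_box_integrals_zero: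
  fixes g :: "'a::euclidean_space \<Rightarrow> real"
  assumes g: "integrable lborel g"
    and zero: "\<And>a b. (\<integral>x. g x * indicator (box a b) x \<partial>lborel) = 0"
  shows "AE x in lborel. g x = 0"
proof -
  have [measurable]: "g \<in> borel_measurable borel" using g by simp
  let ?P = "density lborel (\<lambda>x. ennreal (g x))" and ?N = "density lborel (\<lambda>x. ennreal (- g x))"
  have fin: "(\<integral>\<^sup>+x. ennreal (g x * indicator A x) \<partial>lborel) < \<infinity>"
    "(\<integral>\<^sup>+x. ennreal (- (g x * indicator A x)) \<partial>lborel) < \<infinity>"
    and int: "integrable lborel (\<lambda>x. g x * indicator A x)" if "A \<in> sets borel" for A
  proof -
    show int: "integrable lborel (\<lambda>x. g x * indicator A x)"
      using integrable_mult_indicator[of A lborel g] g that by (simp add: mult.commute)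
    show "(\<integral>\<^sup>+x. ennreal (g x * indicator A x) \<partial>lborel) < \<infinity>"
      "(\<integral>\<^sup>+x. ennreal (- (g x * indicator A x)) \<partial>lborel) < \<infinity>"
      using int by (auto simp: real_integrable_def top.not_eq_extremum)
  qed
  have P: "emeasure ?P A = (\<integral>\<^sup>+x. ennreal (g x * indicator A x) \<partial>lborel)"
    and N: "emeasure ?N A = (\<integral>\<^sup>+x. ennreal (- (g x * indicator A x)) \<partial>lborel)"
    if A: "A \<in> sets borel" for A
    using A by (auto simp: emeasure_density intro!: nn_integral_cong split: split_indicator)
  have "?P = ?N"
  proof (rule measure_eqI_generator_eq)
    let ?E = "range (\<lambda>(a, b). box a b::'a set)"
    let ?A = "\<lambda>n::nat. box (- (real n *\<^sub>R One)) (real n *\<^sub>R One) :: 'a set"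
    show "Int_stable ?E" by (auto simp: Int_stable_def box_Int_box)
    show "?E \<subseteq> Pow UNIV" "sets ?P = sigma_sets UNIV ?E" "sets ?N = sigma_sets UNIV ?E"
      by (simp_all add: borel_eq_box)
    show "range ?A \<subseteq> ?E" "(\<Union>i. ?A i) = UNIV"
      unfolding UN_box_eq_UNIV by auto
    show "emeasure ?P (?A n) \<noteq> \<infinity>" for n using fin[of "?A n"] by (simp add: P)
    fix X assume "X \<in> ?E"
    then obtain a b where X: "X = box a b" by auto
    have "enn2real (\<integral>\<^sup>+x. ennreal (g x * indicator X x) \<partial>lborel)
        = enn2real (\<integral>\<^sup>+x. ennreal (- (g x * indicator X x)) \<partial>lborel)"
      using zero[of a b] int[of X] by (simp add: real_lebesgue_integral_def X)
    then show "emeasure ?P X = emeasure ?N X"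
      using fin[of X] by (metis P N ennreal_enn2real box_borel X infinity_ennreal_def)
  qed
  then have "AE x in lborel. ennreal (g x) = ennreal (- g x)"
    by (intro sigma_finite_measure.density_unique[OF sigma_finite_lborel]) auto
  then show ?thesis
  proof eventually_elim
    case (elim x)
    then show "g x = 0"
      by (cases "0 \<le> g x") (auto simp: ennreal_neg ennreal_eq_0_iff)
  qed
qed

text \<open>The fundamental lemma of the calculus of variations: the bump functions of a box in \<open>D\<close> converge
  to its indicator, so the integral of \<open>g\<close> over every such box vanishes.\<close>

lemma AE_zero_if_test_integrals_zero:
  fixes g :: "'a::euclidean_space \<Rightarrow> real"
  assumes g: "sq_integrable g" and "open D"
    and zero: "\<And>\<phi>. \<phi> \<in> test_functions D \<Longrightarrow> (\<integral>x. g x * \<phi> x \<partial>lborel) = 0"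
  shows "AE x in lborel. x \<in> D \<longrightarrow> g x = 0"
proof -
  have [measurable]: "g \<in> borel_measurable borel" using g by (simp add: sq_integrable_def)
  have int_box: "integrable lborel (\<lambda>x. g x * indicator (box a b) x)" for a b :: 'a
  proof (rule sq_integrable_mult[OF g])
    have "integrable lborel (indicator (box a b) :: 'a \<Rightarrow> real)"
      by (rule integrable_real_indicator) (auto simp: emeasure_lborel_box_eq)
    moreover have "(\<lambda>x. (indicator (box a b) x)\<^sup>2) = (indicator (box a b) :: 'a \<Rightarrow> real)"
      by (auto simp: indicator_def)
    ultimately show "sq_integrable (indicator (box a b) :: 'a \<Rightarrow> real)"
      by (simp add: sq_integrable_def)
  qed
  have box_zero: "(\<integral>x. g x * indicator (box a b) x \<partial>lborel) = 0" if ab: "box a b \<subseteq> D" for a b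
  proof -
    have test: "box_bump a b (Suc n) \<in> test_functions D" for n
      using ab by (intro box_bump_test_function) auto
    have [measurable]: "box_bump a b n \<in> borel_measurable borel" for n
    proof (cases n)
      case 0
      then show ?thesis by (simp add: box_bump_def[abs_def] flat_def)
    next
      case (Suc m)
      then show ?thesis using test_function_continuous[OF test]
        by (simp add: borel_measurable_continuous_onI)
    qed
    have out: "box_bump a b (Suc n) x = 0" if "x \<notin> box a b" for n x
    proof -
      have "box_bump a b (Suc n) \<in> test_functions (box a b)"
        by (intro box_bump_test_function) auto
      then show ?thesis
        using that closure_subset[of "{x. box_bump a b (Suc n) x \<noteq> 0}"]
        by (auto simp: test_functions_def simp del: closure_subset)
    qed
    have "(\<lambda>n. \<integral>x. g x * box_bump a b (Suc n) x \<partial>lborel)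
        \<longlonglongrightarrow> (\<integral>x. g x * indicator (box a b) x \<partial>lborel)"
    proof (rule integral_dominated_convergence)
      show "integrable lborel (\<lambda>x. \<bar>g x * indicator (box a b) x\<bar>)"
        using int_box by (rule integrable_abs)
      show "AE x in lborel. (\<lambda>n. g x * box_bump a b (Suc n) x) \<longlonglongrightarrow> g x * indicator (box a b) x"
        by (intro AE_I2 tendsto_intros LIMSEQ_Suc box_bump_tendsto)
      show "AE x in lborel. norm (g x * box_bump a b (Suc n) x) \<le> \<bar>g x * indicator (box a b) x\<bar>" for n
        using box_bump_bounds[of a b "Suc n"] out[of _ n]
        by (intro AE_I2) (auto simp: abs_mult indicator_def intro!: mult_left_le)
    qed auto
    then have "(\<lambda>n. 0) \<longlonglongrightarrow> (\<integral>x. g x * indicator (box a b) x \<partial>lborel)"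
      using zero[OF test] by simp
    then show ?thesis by (simp add: LIMSEQ_const_iff)
  qed
  have AE_box: "AE x in lborel. x \<in> box a b \<longrightarrow> g x = 0" if ab: "box a b \<subseteq> D" for a b
  proof -
    have "AE x in lborel. g x * indicator (box a b) x = 0"
    proof (rule AE_zero_if_box_integrals_zero[OF int_box])
      fix c d
      obtain p q where pq: "box a b \<inter> box c d = box p q"
        by (simp add: box_Int_box)
      then have "box p q \<subseteq> D" using ab by blast
      moreover have "g x * indicator (box a b) x * indicator (box c d) x = g x * indicator (box p q) x" for x
        unfolding pq[symmetric] by (simp add: indicator_inter_arith mult.assoc)
      ultimately show "(\<integral>x. g x * indicator (box a b) x * indicator (box c d) x \<partial>lborel) = 0"
        using box_zero[of p q] by (simp only:)
    qed
    then show ?thesis by eventually_elim (auto simp: indicator_def)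
  qed
  obtain \<D> where \<D>: "countable \<D>" "\<D> \<subseteq> Pow D" "\<And>X. X \<in> \<D> \<Longrightarrow> \<exists>a b. X = box a b" "\<Union>\<D> = D"
    using open_countable_Union_open_box[OF \<open>open D\<close>] by metis
  have "AE x in lborel. x \<in> X \<longrightarrow> g x = 0" if "X \<in> \<D>" for X
    using \<D>(2) \<D>(3)[OF that] that AE_box by blast
  then have "AE x in lborel. \<forall>X\<in>\<D>. x \<in> X \<longrightarrow> g x = 0"
    using \<D>(1) by (intro AE_ball_countable[THEN iffD2] ballI)
  then show ?thesis by eventually_elim (use \<D>(4) in blast)
qed

text \<open>Written with inner products of classes, both conditions are visibly linear in \<open>u\<close> and \<open>g\<close>.\<close>

lemma is_weak_partial_iff:
  assumes "i \<in> Basis"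
  shows "is_weak_partial D i u g \<longleftrightarrow> g \<in> L2 D \<and> (\<forall>\<phi>\<in>test_functions D.
     inner u (abs_l2 (pderivative i \<phi>)) = - inner g (abs_l2 \<phi>))"
  using assms
  by (simp add: is_weak_partial_def inner_abs_l2 test_function_sq_integrable
      test_function_pderivative(2) cong: ball_cong)

text \<open>Uniqueness makes \<^term>\<open>weak_partial\<close>, a definite description, a linear operator.\<close>

lemma weak_partial_unique:
  assumes D: "open D" "i \<in> Basis" and g: "is_weak_partial D i u g" "is_weak_partial D i u h"
  shows "g = h"
proof -
  have L: "g - h \<in> L2 D" using g by (intro L2_diff) (auto simp: is_weak_partial_def)
  have "AE x in lborel. x \<in> D \<longrightarrow> rep_l2 (g - h) x = 0"
  proof (rule AE_zero_if_test_integrals_zero[OF sq_integrable_rep_l2 D(1)])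
    fix \<phi> assume \<phi>: "\<phi> \<in> test_functions D"
    have "inner (g - h) (abs_l2 \<phi>) = 0"
      using g \<phi> unfolding is_weak_partial_iff[OF D(2)] by (simp add: inner_diff_left)
    then show "(\<integral>x. rep_l2 (g - h) x * \<phi> x \<partial>lborel) = 0"
      by (simp add: inner_abs_l2 test_function_sq_integrable[OF \<phi>])
  qed
  moreover have "AE x in lborel. x \<notin> D \<longrightarrow> rep_l2 (g - h) x = 0"
    using L by (simp add: L2_def)
  ultimately have "AE x in lborel. rep_l2 (g - h) x = rep_l2 0 x"
    using rep_l2_zero by eventually_elim auto
  then have "g - h = 0" by (rule l2_eqI)
  then show ?thesis by simp
qed

lemma weak_partial_eqI:
  assumes "open D" "i \<in> Basis" "is_weak_partial D i u g"
  shows "weak_partial D i u = g"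
  unfolding weak_partial_def using assms weak_partial_unique by blast

lemma is_weak_partial_H01:
  assumes "open D" "i \<in> Basis" "u \<in> H01 D"
  shows "is_weak_partial D i u (weak_partial D i u)"
  using assms weak_partial_eqI[OF assms(1,2)] by (auto simp: H01_def)

lemma weak_partial_add:
  assumes "open D" "i \<in> Basis" "u \<in> H01 D" "v \<in> H01 D"
  shows "weak_partial D i (u + v) = weak_partial D i u + weak_partial D i v"
  using is_weak_partial_H01[OF assms(1,2,3)] is_weak_partial_H01[OF assms(1,2,4)]
  by (intro weak_partial_eqI assms(1,2))
     (auto simp: is_weak_partial_iff[OF assms(2)] inner_add_left intro: L2_add)

lemma weak_partial_scaleR:
  assumes "open D" "i \<in> Basis" "u \<in> H01 D"
  shows "weak_partial D i (r *\<^sub>R u) = r *\<^sub>R weak_partial D i u"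
  using is_weak_partial_H01[OF assms]
  by (intro weak_partial_eqI assms(1,2))
     (auto simp: is_weak_partial_iff[OF assms(2)] intro: L2_scaleR)

lemma grad_inner_commute: "grad_inner D u v = grad_inner D v u"
  by (simp add: grad_inner_def inner_commute)

lemma grad_inner_nonneg: "0 \<le> grad_inner D u u"
  by (simp add: grad_inner_def sum_nonneg)

lemma grad_inner_add_right:
  assumes "open D" "v \<in> H01 D" "w \<in> H01 D"
  shows "grad_inner D u (v + w) = grad_inner D u v + grad_inner D u w"
  using assms by (simp add: grad_inner_def weak_partial_add inner_add_right sum.distrib)

lemma grad_inner_scaleR_right:
  assumes "open D" "v \<in> H01 D"
  shows "grad_inner D u (r *\<^sub>R v) = r * grad_inner D u v"
  using assms by (simp add: grad_inner_def weak_partial_scaleR sum_distrib_left)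


section \<open>Fourth-power integrability in dimensions one and two\<close>

lemma lborel_eq_distr_line:
  assumes "(Basis :: 'a::euclidean_space set) = {i}"
  shows "(lborel :: 'a measure) = distr lborel borel (\<lambda>t. t *\<^sub>R i)"
proof (rule lborel_eqI)
  fix l u :: 'a assume le: "\<And>b. b \<in> Basis \<Longrightarrow> inner l b \<le> inner u b"
  have "i \<in> Basis" using assms by blast
  then have i: "inner i i = 1" by (rule inner_same_Basis)
  have "(\<lambda>t. t *\<^sub>R i) -` box l u = {inner l i<..<inner u i}"
    using i by (auto simp: mem_box assms)
  then show "emeasure (distr lborel borel (\<lambda>t. t *\<^sub>R i)) (box l u) = (\<Prod>b\<in>Basis. (u - l) \<bullet> b)"
    using le by (simp add: emeasure_distr assms inner_diff_left)
qed simp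

text \<open>This identification gives access to Fubini's theorem for a two-dimensional type whose elements are
  not pairs.\<close>

lemma lborel_eq_distr_plane:
  assumes B: "(Basis :: 'a::euclidean_space set) = {i, j}" "i \<noteq> j"
  shows "(lborel :: 'a measure) = distr (lborel \<Otimes>\<^sub>M lborel) borel (\<lambda>(s, t). s *\<^sub>R i + t *\<^sub>R j)"
proof (rule lborel_eqI)
  fix l u :: 'a assume le: "\<And>b. b \<in> Basis \<Longrightarrow> inner l b \<le> inner u b"
  have ij: "inner i i = 1" "inner j j = 1" "inner i j = 0" "inner j i = 0"
  proof -
    have "i \<in> Basis" "j \<in> Basis" using B by blast+
    then show "inner i i = 1" "inner j j = 1" "inner i j = 0" "inner j i = 0"
      using B(2) by (simp_all add: inner_Basis)
  qed
  have le_ij: "inner l i \<le> inner u i" "inner l j \<le> inner u j"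
    using le B(1) by blast+
  have [measurable]: "(\<lambda>(s, t). s *\<^sub>R i + t *\<^sub>R j) \<in> (lborel \<Otimes>\<^sub>M lborel) \<rightarrow>\<^sub>M borel"
    by measurable
  have "(\<lambda>(s, t). s *\<^sub>R i + t *\<^sub>R j) -` box l u
      = {inner l i<..<inner u i} \<times> {inner l j<..<inner u j}"
    using ij by (auto simp: mem_box B inner_add_left)
  then have "emeasure (distr (lborel \<Otimes>\<^sub>M lborel) borel (\<lambda>(s, t). s *\<^sub>R i + t *\<^sub>R j)) (box l u)
      = emeasure (lborel \<Otimes>\<^sub>M lborel) ({inner l i<..<inner u i} \<times> {inner l j<..<inner u j})"
    by (simp add: emeasure_distr space_pair_measure)
  also have "\<dots> = ennreal (inner u i - inner l i) * ennreal (inner u j - inner l j)"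
    using le_ij by (simp add: lborel.emeasure_pair_measure_Times)
  also have "\<dots> = ennreal (\<Prod>b\<in>Basis. (u - l) \<bullet> b)"
    unfolding B(1) using le_ij B(2) by (simp add: inner_diff_left ennreal_mult)
  finally show "emeasure (distr (lborel \<Otimes>\<^sub>M lborel) borel (\<lambda>(s, t). s *\<^sub>R i + t *\<^sub>R j)) (box l u)
      = (\<Prod>b\<in>Basis. (u - l) \<bullet> b)" .
qed simp

lemma nn_integral_plane:
  fixes g :: "'a::euclidean_space \<Rightarrow> ennreal"
  assumes B: "(Basis :: 'a set) = {i, j}" "i \<noteq> j" and [measurable]: "g \<in> borel_measurable borel"
  shows "(\<integral>\<^sup>+x. g x \<partial>lborel) = (\<integral>\<^sup>+s. \<integral>\<^sup>+t. g (s *\<^sub>R i + t *\<^sub>R j) \<partial>lborel \<partial>lborel)"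
proof -
  have "(\<integral>\<^sup>+x. g x \<partial>lborel) = (\<integral>\<^sup>+p. g (fst p *\<^sub>R i + snd p *\<^sub>R j) \<partial>(lborel \<Otimes>\<^sub>M lborel))"
    by (subst lborel_eq_distr_plane[OF B]) (simp add: nn_integral_distr case_prod_unfold)
  also have "\<dots> = (\<integral>\<^sup>+s. \<integral>\<^sup>+t. g (s *\<^sub>R i + t *\<^sub>R j) \<partial>lborel \<partial>lborel)"
    by (subst lborel.nn_integral_fst[symmetric]) simp_all
  finally show ?thesis .
qed

text \<open>The derivative of \<open>\<phi>\<^sup>2\<close> along a line is \<open>2 \<phi> \<partial>\<^sub>i\<phi>\<close>, whose modulus is at most
  \<open>\<phi>\<^sup>2 + (\<partial>\<^sub>i\<phi>)\<^sup>2\<close>, and \<open>\<phi>\<close> vanishes far out on the line.\<close>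

lemma test_function_sq_le_line_integral:
  assumes \<phi>: "\<phi> \<in> test_functions D" and i: "i \<in> Basis"
  shows "ennreal ((\<phi> (y + s *\<^sub>R i))\<^sup>2)
    \<le> (\<integral>\<^sup>+t. ennreal ((\<phi> (y + t *\<^sub>R i))\<^sup>2 + (pderivative i \<phi> (y + t *\<^sub>R i))\<^sup>2) \<partial>lborel)"
proof -
  have "bounded {x. \<phi> x \<noteq> 0}"
    using \<phi> closure_subset bounded_subset compact_imp_bounded by (force simp: test_functions_def)
  then obtain R where R: "\<And>x. \<phi> x \<noteq> 0 \<Longrightarrow> norm x \<le> R"
    by (auto simp: bounded_iff)
  \<comment> \<open>a parameter left of \<open>s\<close> at which the line has left the support\<close>
  define r where "r = - (\<bar>R\<bar> + norm y + \<bar>s\<bar> + 1)"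
  have "r \<le> s" unfolding r_def using norm_ge_zero[of y] by linarith
  have "norm (r *\<^sub>R i) \<le> norm (y + r *\<^sub>R i) + norm y"
    using norm_triangle_ineq4[of "y + r *\<^sub>R i" y] by simp
  then have "R < norm (y + r *\<^sub>R i)"
    using i unfolding r_def by (simp add: norm_Basis)
  then have zero: "\<phi> (y + r *\<^sub>R i) = 0" using R[of "y + r *\<^sub>R i"] by auto
  let ?h = "\<lambda>t. (\<phi> (y + t *\<^sub>R i))\<^sup>2"
    and ?d = "\<lambda>t. 2 * \<phi> (y + t *\<^sub>R i) * pderivative i \<phi> (y + t *\<^sub>R i)"
    and ?e = "\<lambda>t. (\<phi> (y + t *\<^sub>R i))\<^sup>2 + (pderivative i \<phi> (y + t *\<^sub>R i))\<^sup>2"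
  have cont: "continuous_on UNIV (\<lambda>t. \<phi> (y + t *\<^sub>R i))" "continuous_on UNIV (\<lambda>t. pderivative i \<phi> (y + t *\<^sub>R i))"
    by (auto intro!: continuous_on_compose2[OF test_function_continuous[OF \<phi>]]
        continuous_on_compose2[OF test_function_pderivative(1)[OF \<phi> i]] continuous_intros)
  have der: "((\<lambda>t. \<phi> (y + t *\<^sub>R i)) has_real_derivative pderivative i \<phi> (y + t *\<^sub>R i)) (at t)" for t
  proof -
    let ?f' = "frechet_derivative \<phi> (at (y + t *\<^sub>R i))"
    have "((\<lambda>t. \<phi> (y + t *\<^sub>R i)) has_derivative (\<lambda>h. ?f' (h *\<^sub>R i))) (at t)"
      by (rule has_derivative_compose[OF _ test_function_has_derivative[OF \<phi>]])
         (auto intro!: derivative_eq_intros)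
    moreover have "(\<lambda>h. ?f' (h *\<^sub>R i)) = (*) (pderivative i \<phi> (y + t *\<^sub>R i))"
      using linear_scale[OF has_derivative_linear[OF test_function_has_derivative[OF \<phi>]]]
      by (auto simp: pderivative_def mult.commute)
    ultimately show ?thesis by (simp add: has_field_derivative_def)
  qed
  have dh: "DERIV ?h t :> ?d t" for t
    by (auto intro!: derivative_eq_intros der)
  have "continuous_on UNIV ?d" by (intro continuous_intros cont)
  then have "has_bochner_integral lborel (\<lambda>t. ?d t * indicator {r..s} t) (?h s - ?h r)"
    by (intro has_bochner_integral_FTC_Icc_real \<open>r \<le> s\<close> dh)
       (auto simp: continuous_on_eq_continuous_at)
  then have int: "integrable lborel (\<lambda>t. ?d t * indicator {r..s} t)"
    and eq: "?h s = norm (\<integral>t. ?d t * indicator {r..s} t \<partial>lborel)"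
    using zero by (auto simp: has_bochner_integral_iff)
  have "ennreal (?h s) \<le> (\<integral>\<^sup>+t. ennreal (norm (?d t * indicator {r..s} t)) \<partial>lborel)"
    unfolding eq by (rule integral_norm_bound_ennreal[OF int])
  moreover have "norm (?d t * indicator {r..s} t) \<le> ?e t" for t
    using sum_squares_bound[of "\<phi> (y + t *\<^sub>R i)" "pderivative i \<phi> (y + t *\<^sub>R i)"]
      sum_squares_bound[of "- \<phi> (y + t *\<^sub>R i)" "pderivative i \<phi> (y + t *\<^sub>R i)"]
    by (auto simp: indicator_def abs_le_iff)
  ultimately show ?thesis
    by (meson ennreal_leI nn_integral_mono order_trans)
qed

definition H1_norm_sq :: "('a::euclidean_space \<Rightarrow> real) \<Rightarrow> real" where
  "H1_norm_sq \<phi> = (norm (abs_l2 \<phi>))\<^sup>2 + (\<Sum>i\<in>Basis. (norm (abs_l2 (pderivative i \<phi>)))\<^sup>2)"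

lemma nn_integral_sq_plus_pderivative_sq_le:
  assumes \<phi>: "\<phi> \<in> test_functions D" and i: "i \<in> Basis"
  shows "(\<integral>\<^sup>+x. ennreal ((\<phi> x)\<^sup>2 + (pderivative i \<phi> x)\<^sup>2) \<partial>lborel) \<le> ennreal (H1_norm_sq \<phi>)"
proof -
  have sq: "sq_integrable \<phi>" "sq_integrable (pderivative i \<phi>)"
    using \<phi> i by (auto intro: test_function_sq_integrable test_function_pderivative)
  then have "(\<integral>\<^sup>+x. ennreal ((\<phi> x)\<^sup>2 + (pderivative i \<phi> x)\<^sup>2) \<partial>lborel)
      = ennreal (\<integral>x. (\<phi> x)\<^sup>2 + (pderivative i \<phi> x)\<^sup>2 \<partial>lborel)"
    by (intro nn_integral_eq_integral) (auto simp: sq_integrable_def)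
  also have "(\<integral>x. (\<phi> x)\<^sup>2 + (pderivative i \<phi> x)\<^sup>2 \<partial>lborel)
      = (norm (abs_l2 \<phi>))\<^sup>2 + (norm (abs_l2 (pderivative i \<phi>)))\<^sup>2"
    using sq by (simp add: norm_abs_l2 sq_integrable_def)
  also have "ennreal \<dots> \<le> ennreal (H1_norm_sq \<phi>)"
    unfolding H1_norm_sq_def using i
    by (intro ennreal_leI add_left_mono member_le_sum) auto
  finally show ?thesis .
qed

lemma nn_integral_sq_le:
  assumes \<phi>: "\<phi> \<in> test_functions D"
  shows "(\<integral>\<^sup>+x. ennreal ((\<phi> x)\<^sup>2) \<partial>lborel) \<le> ennreal (H1_norm_sq \<phi>)"
proof -
  obtain i :: 'a where "i \<in> Basis" using nonempty_Basis by blast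
  have "(\<integral>\<^sup>+x. ennreal ((\<phi> x)\<^sup>2) \<partial>lborel)
      \<le> (\<integral>\<^sup>+x. ennreal ((\<phi> x)\<^sup>2 + (pderivative i \<phi> x)\<^sup>2) \<partial>lborel)"
    by (intro nn_integral_mono ennreal_leI) simp
  also have "\<dots> \<le> ennreal (H1_norm_sq \<phi>)"
    by (rule nn_integral_sq_plus_pderivative_sq_le) fact+
  finally show ?thesis .
qed

text \<open>Ladyzhenskaya's argument: in the plane \<open>\<phi>\<^sup>2\<close> is bounded by a function of the second coordinate
  alone and by a function of the first coordinate alone, so the integral of \<open>\<phi>\<^sup>4\<close> is at most the
  product of their integrals. On the line \<open>\<phi>\<^sup>2\<close> is bounded by a constant.\<close>

lemma test_function_L4_bound:
  fixes \<phi> :: "'a::euclidean_space \<Rightarrow> real"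
  assumes dim: "DIM('a) = 1 \<or> DIM('a) = 2" and \<phi>: "\<phi> \<in> test_functions D"
  shows "(\<integral>\<^sup>+x. ennreal ((\<phi> x) ^ 4) \<partial>lborel) \<le> ennreal ((H1_norm_sq \<phi>)\<^sup>2)"
proof -
  have M: "0 \<le> H1_norm_sq \<phi>" by (simp add: H1_norm_sq_def sum_nonneg)
  have [measurable]: "\<phi> \<in> borel_measurable borel"
    using test_function_continuous[OF \<phi>] by (rule borel_measurable_continuous_onI)
  have [measurable]: "pderivative i \<phi> \<in> borel_measurable borel" if "i \<in> Basis" for i
    using test_function_pderivative(1)[OF \<phi> that] by (rule borel_measurable_continuous_onI)
  have pow4: "ennreal ((\<phi> x) ^ 4) = ennreal ((\<phi> x)\<^sup>2) * ennreal ((\<phi> x)\<^sup>2)" for x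
    by (simp add: ennreal_mult[symmetric] power_add[symmetric])
  define e where "e i x = ennreal ((\<phi> x)\<^sup>2 + (pderivative i \<phi> x)\<^sup>2)" for i x
  have [measurable]: "e i \<in> borel_measurable borel" if "i \<in> Basis" for i
    unfolding e_def[abs_def] using that by measurable
  have e_le: "(\<integral>\<^sup>+x. e i x \<partial>lborel) \<le> ennreal (H1_norm_sq \<phi>)" if "i \<in> Basis" for i
    unfolding e_def by (rule nn_integral_sq_plus_pderivative_sq_le[OF \<phi> that])
  have line: "ennreal ((\<phi> (y + s *\<^sub>R i))\<^sup>2) \<le> (\<integral>\<^sup>+t. e i (y + t *\<^sub>R i) \<partial>lborel)" if "i \<in> Basis" for i y s
    unfolding e_def by (rule test_function_sq_le_line_integral[OF \<phi> that])
  show ?thesis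
    using dim
  proof
    assume "DIM('a) = 1"
    then obtain i :: 'a where B: "Basis = {i}" by (metis card_1_singletonE)
    then have i: "i \<in> Basis" by blast
    have "ennreal ((\<phi> x)\<^sup>2) \<le> ennreal (H1_norm_sq \<phi>)" for x
    proof -
      have "x = inner x i *\<^sub>R i" using euclidean_representation[of x] unfolding B by simp
      then have "ennreal ((\<phi> x)\<^sup>2) \<le> (\<integral>\<^sup>+t. e i (0 + t *\<^sub>R i) \<partial>lborel)"
        using line[OF i, of 0 "inner x i"] by simp
      also have "\<dots> = (\<integral>\<^sup>+x. e i x \<partial>lborel)"
        using i by (subst lborel_eq_distr_line[OF B]) (simp add: nn_integral_distr)
      finally show ?thesis using e_le[OF i] by (rule order_trans)
    qed
    then have "(\<integral>\<^sup>+x. ennreal ((\<phi> x) ^ 4) \<partial>lborel)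
        \<le> (\<integral>\<^sup>+x. ennreal (H1_norm_sq \<phi>) * ennreal ((\<phi> x)\<^sup>2) \<partial>lborel)"
      unfolding pow4 by (intro nn_integral_mono mult_right_mono) auto
    also have "\<dots> = ennreal (H1_norm_sq \<phi>) * (\<integral>\<^sup>+x. ennreal ((\<phi> x)\<^sup>2) \<partial>lborel)"
      by (rule nn_integral_cmult) measurable
    also have "\<dots> \<le> ennreal (H1_norm_sq \<phi>) * ennreal (H1_norm_sq \<phi>)"
      by (intro mult_left_mono nn_integral_sq_le[OF \<phi>]) simp
    finally show ?thesis using M by (simp add: ennreal_mult[symmetric] power2_eq_square)
  next
    assume "DIM('a) = 2"
    then obtain i j :: 'a where B: "Basis = {i, j}" "i \<noteq> j" by (metis card_2_iff)
    then have ij: "i \<in> Basis" "j \<in> Basis" by blast+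
    have B': "Basis = {j, i}" "j \<noteq> i" using B by auto
    define A where "A t = (\<integral>\<^sup>+s. e i (t *\<^sub>R j + s *\<^sub>R i) \<partial>lborel)" for t
    define C where "C s = (\<integral>\<^sup>+t. e j (s *\<^sub>R i + t *\<^sub>R j) \<partial>lborel)" for s
    have [measurable]: "A \<in> borel_measurable borel" "C \<in> borel_measurable borel"
      unfolding A_def[abs_def] C_def[abs_def] using ij by measurable
    have "(\<integral>\<^sup>+x. ennreal ((\<phi> x) ^ 4) \<partial>lborel)
        = (\<integral>\<^sup>+s. \<integral>\<^sup>+t. ennreal ((\<phi> (s *\<^sub>R i + t *\<^sub>R j)) ^ 4) \<partial>lborel \<partial>lborel)"
      by (rule nn_integral_plane[OF B]) measurable
    also have "\<dots> \<le> (\<integral>\<^sup>+s. \<integral>\<^sup>+t. C s * A t \<partial>lborel \<partial>lborel)"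
      unfolding pow4
    proof (intro nn_integral_mono mult_mono)
      fix s t :: real
      show "ennreal ((\<phi> (s *\<^sub>R i + t *\<^sub>R j))\<^sup>2) \<le> C s"
        unfolding C_def by (rule line[OF ij(2)])
      show "ennreal ((\<phi> (s *\<^sub>R i + t *\<^sub>R j))\<^sup>2) \<le> A t"
        unfolding A_def by (subst add.commute) (rule line[OF ij(1)])
    qed simp_all
    also have "\<dots> = (\<integral>\<^sup>+s. C s \<partial>lborel) * (\<integral>\<^sup>+t. A t \<partial>lborel)"
      by (simp add: nn_integral_cmult nn_integral_multc)
    also have "(\<integral>\<^sup>+s. C s \<partial>lborel) = (\<integral>\<^sup>+x. e j x \<partial>lborel)"
      unfolding C_def using ij by (intro nn_integral_plane[OF B, symmetric]) measurable
    also have "(\<integral>\<^sup>+t. A t \<partial>lborel) = (\<integral>\<^sup>+x. e i x \<partial>lborel)"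
      unfolding A_def using ij by (intro nn_integral_plane[OF B', symmetric]) measurable
    also have "(\<integral>\<^sup>+x. e j x \<partial>lborel) * (\<integral>\<^sup>+x. e i x \<partial>lborel)
        \<le> ennreal (H1_norm_sq \<phi>) * ennreal (H1_norm_sq \<phi>)"
      using ij by (intro mult_mono e_le) simp_all
    finally show ?thesis using M by (simp add: ennreal_mult[symmetric] power2_eq_square)
  qed
qed

text \<open>Convergence in \<open>L\<^sup>2\<close> is convergence to zero in \<open>L\<^sup>1\<close> of the squared differences, which along a
  subsequence tend to zero almost everywhere.\<close>

lemma AE_convergent_subsequence:
  fixes u :: "'a::euclidean_space l2"
  assumes \<phi>: "\<And>k. sq_integrable (\<phi> k)" and lim: "(\<lambda>k. abs_l2 (\<phi> k)) \<longlonglongrightarrow> u"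
  obtains r :: "nat \<Rightarrow> nat" where "strict_mono r" "AE x in lborel. (\<lambda>k. \<phi> (r k) x) \<longlonglongrightarrow> rep_l2 u x"
proof -
  let ?d = "\<lambda>k x. \<phi> k x - rep_l2 u x"
  have sq: "sq_integrable (?d k)" for k
    using sq_integrable_add[OF \<phi> sq_integrable_scale[OF sq_integrable_rep_l2, of "-1" u], of k] by simp
  have "abs_l2 (?d k) = abs_l2 (\<phi> k) - u" for k
  proof (rule l2_eqI)
    show "AE x in lborel. rep_l2 (abs_l2 (?d k)) x = rep_l2 (abs_l2 (\<phi> k) - u) x"
      using rep_abs_l2[OF sq[of k]] rep_abs_l2[OF \<phi>[of k]] rep_l2_diff[of "abs_l2 (\<phi> k)" u]
      by eventually_elim simp
  qed
  then have "(\<integral>x. norm ((?d k x)\<^sup>2) \<partial>lborel) = (norm (abs_l2 (\<phi> k) - u))\<^sup>2" for k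
    using norm_abs_l2[OF sq[of k]] by simp
  moreover have "(\<lambda>k. (norm (abs_l2 (\<phi> k) - u))\<^sup>2) \<longlonglongrightarrow> 0\<^sup>2"
    using lim by (intro tendsto_power tendsto_norm_zero) (simp add: LIM_zero)
  ultimately have "(\<lambda>k. \<integral>x. norm ((?d k x)\<^sup>2) \<partial>lborel) \<longlonglongrightarrow> 0" by simp
  then obtain r :: "nat \<Rightarrow> nat" where r: "strict_mono r"
    and AE: "AE x in lborel. (\<lambda>k. (?d (r k) x)\<^sup>2) \<longlonglongrightarrow> 0"
    using tendsto_L1_AE_subseq[of lborel "\<lambda>k x. (?d k x)\<^sup>2"] sq
    by (auto simp: sq_integrable_def)
  from AE have "AE x in lborel. (\<lambda>k. \<phi> (r k) x) \<longlonglongrightarrow> rep_l2 u x"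
  proof eventually_elim
    case (elim x)
    from tendsto_real_sqrt[OF elim] have "(\<lambda>k. ?d (r k) x) \<longlonglongrightarrow> 0"
      by (simp add: tendsto_rabs_zero_iff)
    then show ?case by (rule LIM_zero_cancel)
  qed
  with r show thesis by (rule that)
qed

text \<open>The \<open>L\<^sup>4\<close> bound is uniform along an approximating sequence of test functions, since their \<open>H\<^sup>1\<close> norms
  converge, and it passes to the limit by Fatou's lemma.\<close>

lemma H01_L4:
  fixes u :: "'a::euclidean_space l2"
  assumes dim: "DIM('a) = 1 \<or> DIM('a) = 2" and u: "u \<in> H01 D"
  shows "integrable lborel (\<lambda>x. (rep_l2 u x) ^ 4)"
proof -
  obtain \<phi> :: "nat \<Rightarrow> 'a \<Rightarrow> real" where \<phi>: "\<And>k. \<phi> k \<in> test_functions D"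
    and lim: "(\<lambda>k. abs_l2 (\<phi> k)) \<longlonglongrightarrow> u"
    and lim': "\<And>i. i \<in> Basis \<Longrightarrow> \<exists>g. (\<lambda>k. abs_l2 (pderivative i (\<phi> k))) \<longlonglongrightarrow> g"
    using u unfolding H01_def by blast
  obtain g where g: "\<And>i. i \<in> Basis \<Longrightarrow> (\<lambda>k. abs_l2 (pderivative i (\<phi> k))) \<longlonglongrightarrow> g i"
    using lim' by metis
  have "(\<lambda>k. (H1_norm_sq (\<phi> k))\<^sup>2) \<longlonglongrightarrow> ((norm u)\<^sup>2 + (\<Sum>i\<in>Basis. (norm (g i))\<^sup>2))\<^sup>2"
    unfolding H1_norm_sq_def by (intro tendsto_intros lim g)
  then have "Bseq (\<lambda>k. (H1_norm_sq (\<phi> k))\<^sup>2)"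
    using convergentI convergent_imp_Bseq by blast
  then obtain K where K: "\<And>k. (H1_norm_sq (\<phi> k))\<^sup>2 \<le> K"
    unfolding Bseq_def by (metis abs_le_D1 real_norm_def)
  have [measurable]: "\<phi> k \<in> borel_measurable borel" for k
    using test_function_continuous[OF \<phi>] by (rule borel_measurable_continuous_onI)
  obtain r :: "nat \<Rightarrow> nat" where r: "strict_mono r"
    and AE: "AE x in lborel. (\<lambda>k. \<phi> (r k) x) \<longlonglongrightarrow> rep_l2 u x"
    using AE_convergent_subsequence[OF test_function_sq_integrable[OF \<phi>] lim] .
  have "(\<integral>\<^sup>+x. ennreal ((rep_l2 u x) ^ 4) \<partial>lborel)
      = (\<integral>\<^sup>+x. liminf (\<lambda>k. ennreal ((\<phi> (r k) x) ^ 4)) \<partial>lborel)"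
  proof (rule nn_integral_cong_AE)
    show "AE x in lborel. ennreal ((rep_l2 u x) ^ 4) = liminf (\<lambda>k. ennreal ((\<phi> (r k) x) ^ 4))"
      using AE
    proof eventually_elim
      case (elim x)
      then have "(\<lambda>k. ennreal ((\<phi> (r k) x) ^ 4)) \<longlonglongrightarrow> ennreal ((rep_l2 u x) ^ 4)"
        by (intro tendsto_ennrealI tendsto_power)
      then show ?case by (rule lim_imp_Liminf[OF sequentially_bot, symmetric])
    qed
  qed
  also have "\<dots> \<le> liminf (\<lambda>k. \<integral>\<^sup>+x. ennreal ((\<phi> (r k) x) ^ 4) \<partial>lborel)"
    by (rule nn_integral_liminf) measurable
  also have "\<dots> \<le> liminf (\<lambda>k :: nat. ennreal K)"
    using order_trans[OF test_function_L4_bound[OF dim \<phi>] ennreal_leI[OF K]]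
    by (intro Liminf_mono always_eventually allI)
  also have "\<dots> < \<infinity>" by (simp add: Liminf_const)
  finally show ?thesis by (intro integrableI_nonneg) auto
qed


section \<open>Functions of a symmetric operator on a finite-dimensional space\<close>

text \<open>The ambient space is infinite-dimensional, so closed bounded sets need not be compact. Compactness
  of the unit sphere of a finite-dimensional subspace is obtained from the images of finite products
  of intervals.\<close>

lemma compact_coordinate_box:
  fixes B :: "'b::real_inner set"
  assumes "finite B"
  shows "compact {x. \<exists>k. (\<forall>b\<in>B. \<bar>k b\<bar> \<le> 1) \<and> x = (\<Sum>b\<in>B. k b *\<^sub>R b)}"
  using assms
proof (induction rule: finite_induct)
  case empty
  have "{x :: 'b. \<exists>k. (\<forall>b\<in>{}. \<bar>k b\<bar> \<le> (1::real)) \<and> x = (\<Sum>b\<in>{}. k b *\<^sub>R b)} = {0}" by auto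
  then show ?case by simp
next
  case (insert b B)
  let ?K = "\<lambda>B::'b set. {x. \<exists>k. (\<forall>b\<in>B. \<bar>k b\<bar> \<le> 1) \<and> x = (\<Sum>b\<in>B. k b *\<^sub>R b)}"
  have "?K (insert b B) = (\<lambda>(t, x). t *\<^sub>R b + x) ` ({-1..1} \<times> ?K B)"
  proof (intro equalityI subsetI)
    fix x assume "x \<in> ?K (insert b B)"
    then obtain k where k: "\<forall>c\<in>insert b B. \<bar>k c\<bar> \<le> 1" "x = (\<Sum>c\<in>insert b B. k c *\<^sub>R c)"
      by auto
    then have "x = k b *\<^sub>R b + (\<Sum>c\<in>B. k c *\<^sub>R c)" using insert.hyps by simp
    moreover have "k b \<in> {-1..1}" using k(1) by (auto simp: abs_le_iff)
    moreover have "(\<Sum>c\<in>B. k c *\<^sub>R c) \<in> ?K B" using k(1) by auto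
    ultimately show "x \<in> (\<lambda>(t, x). t *\<^sub>R b + x) ` ({-1..1} \<times> ?K B)"
      by (intro image_eqI[of _ _ "(k b, \<Sum>c\<in>B. k c *\<^sub>R c)"]) simp_all
  next
    fix x assume "x \<in> (\<lambda>(t, x). t *\<^sub>R b + x) ` ({-1..1} \<times> ?K B)"
    then obtain t k where t: "t \<in> {-1..1}" and k: "\<forall>c\<in>B. \<bar>k c\<bar> \<le> 1"
      and x: "x = t *\<^sub>R b + (\<Sum>c\<in>B. k c *\<^sub>R c)"
      by auto
    have "x = (\<Sum>c\<in>insert b B. (k(b := t)) c *\<^sub>R c)"
      using insert.hyps x by (auto intro!: sum.cong)
    moreover have "\<forall>c\<in>insert b B. \<bar>(k(b := t)) c\<bar> \<le> 1"
      using t k by (auto simp: abs_le_iff)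
    ultimately show "x \<in> ?K (insert b B)" by blast
  qed
  moreover have "compact ((\<lambda>(t, x). t *\<^sub>R b + x) ` ({-1..1::real} \<times> ?K B))"
    by (intro compact_continuous_image compact_Times insert.IH compact_Icc)
       (auto simp: case_prod_unfold intro!: continuous_intros)
  ultimately show ?case by simp
qed

definition orthonormal :: "'b::real_inner set \<Rightarrow> bool" where
  "orthonormal E \<longleftrightarrow> pairwise orthogonal E \<and> (\<forall>e\<in>E. norm e = 1)"

lemma orthonormal_inner:
  "orthonormal E \<Longrightarrow> a \<in> E \<Longrightarrow> b \<in> E \<Longrightarrow> inner a b = (if a = b then 1 else 0)"
  unfolding orthonormal_def pairwise_def orthogonal_def norm_eq_1 by (cases "a = b") auto

lemma orthonormal_inner_sum:
  assumes "orthonormal E" "finite E" "e \<in> E"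
  shows "inner (\<Sum>b\<in>E. k b *\<^sub>R b) e = k e"
proof -
  have "inner (\<Sum>b\<in>E. k b *\<^sub>R b) e = (\<Sum>b\<in>E. if b = e then k b else 0)"
    unfolding inner_sum_left
    by (rule sum.cong) (use assms in \<open>auto simp: orthonormal_inner\<close>)
  then show ?thesis using assms by simp
qed

lemma orthonormal_expansion:
  assumes "orthonormal E" "finite E" "x \<in> span E"
  shows "x = (\<Sum>e\<in>E. inner x e *\<^sub>R e)"
proof -
  obtain k where k: "x = (\<Sum>e\<in>E. k e *\<^sub>R e)"
    using assms(2,3) by (auto simp: span_finite)
  then have "\<And>e. e \<in> E \<Longrightarrow> inner x e = k e"
    using assms by (simp add: orthonormal_inner_sum)
  then show ?thesis using k by (metis (no_types, lifting) sum.cong)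
qed

lemma orthonormal_parseval:
  assumes "orthonormal E" "finite E" "x \<in> span E"
  shows "inner x y = (\<Sum>e\<in>E. inner x e * inner y e)"
proof -
  have "inner x y = inner (\<Sum>e\<in>E. inner x e *\<^sub>R e) y"
    using orthonormal_expansion[OF assms] by simp
  also have "\<dots> = (\<Sum>e\<in>E. inner x e * inner e y)"
    by (simp only: inner_sum_left inner_scaleR_left)
  finally show ?thesis by (simp add: inner_commute[of y])
qed

lemma orthonormal_basis_exists:
  fixes B :: "'b::real_inner set"
  assumes "finite B"
  obtains E where "finite E" "orthonormal E" "span E = span B"
proof -
  obtain C where C: "finite C" "span C = span B" "pairwise orthogonal C"
    using basis_orthogonal[OF assms] by blast
  define E where "E = (\<lambda>x. x /\<^sub>R norm x) ` (C - {0})"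
  have "finite E" using C by (simp add: E_def)
  moreover have "orthonormal E"
    using C(3) by (fastforce simp: orthonormal_def E_def pairwise_def orthogonal_def)
  moreover have "span E = span C"
  proof
    show "span E \<subseteq> span C"
      unfolding E_def by (intro span_minimal) (auto intro: span_scale span_base)
    have "c \<in> span E" if "c \<in> C" for c
    proof (cases "c = 0")
      case False
      then have "c = norm c *\<^sub>R (c /\<^sub>R norm c)" by simp
      moreover have "c /\<^sub>R norm c \<in> E" using that False by (auto simp: E_def)
      ultimately show ?thesis by (metis span_base span_scale)
    qed (simp add: span_zero)
    then show "span C \<subseteq> span E" by (intro span_minimal) auto
  qed
  ultimately show thesis using C(2) that by simp
qed

lemma compact_unit_sphere_span:
  fixes B :: "'b::real_inner set"
  assumes "finite B"
  shows "compact (span B \<inter> sphere 0 1)"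
proof -
  obtain E where E: "finite E" "orthonormal E" "span E = span B"
    using orthonormal_basis_exists[OF assms] .
  let ?K = "{x. \<exists>k. (\<forall>b\<in>E. \<bar>k b\<bar> \<le> 1) \<and> x = (\<Sum>b\<in>E. k b *\<^sub>R b)}"
  have "span B \<inter> sphere 0 1 = ?K \<inter> sphere 0 1"
  proof (intro equalityI subsetI)
    fix x assume x: "x \<in> span B \<inter> sphere 0 1"
    have "\<bar>inner x e\<bar> \<le> 1" if "e \<in> E" for e
      using Cauchy_Schwarz_ineq2[of x e] x that E(2) by (auto simp: orthonormal_def)
    moreover have "x = (\<Sum>e\<in>E. inner x e *\<^sub>R e)"
      using orthonormal_expansion[OF E(2,1)] x E(3) by simp
    ultimately have "x \<in> ?K" by blast
    with x show "x \<in> ?K \<inter> sphere 0 1" by blast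
  next
    fix x assume "x \<in> ?K \<inter> sphere 0 1"
    then show "x \<in> span B \<inter> sphere 0 1"
      unfolding E(3)[symmetric] by (auto intro!: span_sum span_scale intro: span_base)
  qed
  moreover have closed_unit_sphere: "closed (sphere (0::'b) 1)"
    unfolding sphere_def by (intro closed_Collect_eq continuous_intros)
  then have "compact (?K \<inter> sphere 0 1)"
    by (rule compact_Int_closed[OF compact_coordinate_box[OF E(1)]])
  ultimately show ?thesis
    by simp
qed

text \<open>A maximiser of the Rayleigh quotient is an eigenvector: with \<open>\<mu>\<close> the maximum, the form
  \<open>\<mu> \<langle>y, y\<rangle> - \<langle>A y, y\<rangle>\<close> is nonnegative and vanishes at the maximiser \<open>x\<close>, so its derivative at
  \<open>x\<close> in the direction \<open>\<mu> x - A x\<close> vanishes. The maximum exists because the unit sphere of \<open>S\<close> is a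
  closed subset of the compact unit sphere of \<open>span B\<close>. The set \<open>K\<close> stands for the orthogonal
  complement of the eigenvectors found so far.\<close>

lemma eigenvector_exists:
  fixes A :: "'b::real_inner \<Rightarrow> 'b"
  assumes "finite B"
    and S: "subspace S" "S = span B \<inter> K" "closed K" "x0 \<in> S" "x0 \<noteq> 0"
    and inv: "\<And>x. x \<in> S \<Longrightarrow> A x \<in> S"
    and add: "\<And>x y. x \<in> span B \<Longrightarrow> y \<in> span B \<Longrightarrow> A (x + y) = A x + A y"
    and scale: "\<And>r x. x \<in> span B \<Longrightarrow> A (r *\<^sub>R x) = r *\<^sub>R A x"
    and sym: "\<And>x y. x \<in> span B \<Longrightarrow> y \<in> span B \<Longrightarrow> inner (A x) y = inner x (A y)"
  obtains x \<mu> where "x \<in> S" "norm x = 1" "A x = \<mu> *\<^sub>R x"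
proof -
  obtain E where E: "finite E" "orthonormal E" "span E = span B"
    using orthonormal_basis_exists[OF assms(1)] .
  have Asum: "A (\<Sum>e\<in>F. k e *\<^sub>R e) = (\<Sum>e\<in>F. k e *\<^sub>R A e)"
    if "finite F" "F \<subseteq> E" for F k
    using that
  proof (induction rule: finite_induct)
    case empty
    show ?case using scale[of 0 0] by (simp add: span_zero)
  next
    case (insert e F)
    have "(\<Sum>e\<in>F. k e *\<^sub>R e) \<in> span B" "e \<in> span B"
      unfolding E(3)[symmetric] using insert.prems
      by (auto intro!: span_sum span_scale intro: span_base)
    then show ?case using insert by (simp add: add scale span_scale)
  qed
  have A_eq: "A x = (\<Sum>e\<in>E. inner x e *\<^sub>R A e)" if "x \<in> span B" for x
    using Asum[OF E(1) subset_refl, of "inner x"] orthonormal_expansion[OF E(2,1), of x] that E(3)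
    by simp
  define q where "q x = inner (\<Sum>e\<in>E. inner x e *\<^sub>R A e) x" for x
  have q: "q x = inner (A x) x" if "x \<in> span B" for x
    using A_eq[OF that] by (simp add: q_def)
  have "compact (span B \<inter> sphere 0 1 \<inter> K)"
    using compact_unit_sphere_span[OF assms(1)] S(3) by (rule compact_Int_closed)
  moreover have "x0 /\<^sub>R norm x0 \<in> S"
    using S by (intro subspace_scale) auto
  then have "x0 /\<^sub>R norm x0 \<in> span B \<inter> sphere 0 1 \<inter> K"
    using S(2,5) by auto
  moreover have "continuous_on (span B \<inter> sphere 0 1 \<inter> K) q"
    unfolding q_def by (intro continuous_intros)
  ultimately obtain x where x: "x \<in> span B \<inter> sphere 0 1 \<inter> K"
    and max: "\<And>y. y \<in> span B \<inter> sphere 0 1 \<inter> K \<Longrightarrow> q y \<le> q x"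
    by (metis continuous_attains_sup empty_iff)
  define \<mu> where "\<mu> = q x"
  have xS: "x \<in> S" and nx: "norm x = 1" using x S(2) by auto
  have SB: "y \<in> span B" if "y \<in> S" for y using that S(2) by simp
  have qle: "inner (A y) y \<le> \<mu> * inner y y" if y: "y \<in> S" for y
  proof (cases "y = 0")
    case False
    have yn: "y /\<^sub>R norm y \<in> S" using y S(1) by (intro subspace_scale)
    then have "q (y /\<^sub>R norm y) \<le> \<mu>"
      unfolding \<mu>_def using S(2) False by (intro max) auto
    then have "inner (A (y /\<^sub>R norm y)) (y /\<^sub>R norm y) \<le> \<mu>" using q[OF SB[OF yn]] by simp
    then have "inner (A y) y / (norm y)\<^sup>2 \<le> \<mu>"
      using scale[OF SB[OF y]] by (simp add: power2_eq_square divide_inverse mult_ac)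
    then show ?thesis
      using False by (simp add: divide_le_eq power2_norm_eq_inner)
  qed simp
  define z where "z = \<mu> *\<^sub>R x - A x"
  have zS: "z \<in> S" unfolding z_def using S(1) xS inv by (intro subspace_diff subspace_scale)
  have qx: "inner (A x) x = \<mu>" using q[OF SB[OF xS]] by (simp add: \<mu>_def)
  have ix: "inner x x = 1" using nx by (simp add: norm_eq_1)
  have key: "0 \<le> 2 * t * inner z z + t\<^sup>2 * (\<mu> * inner z z - inner (A z) z)" for t
  proof -
    have tz: "t *\<^sub>R z \<in> S" using S(1) zS by (rule subspace_scale)
    have "x + t *\<^sub>R z \<in> S" using S(1) xS tz by (rule subspace_add)
    from qle[OF this] have "inner (A (x + t *\<^sub>R z)) (x + t *\<^sub>R z)
        \<le> \<mu> * inner (x + t *\<^sub>R z) (x + t *\<^sub>R z)" .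
    moreover have "A (x + t *\<^sub>R z) = A x + t *\<^sub>R A z"
      using add[OF SB[OF xS] SB[OF tz]] scale[OF SB[OF zS]] by simp
    moreover have "inner (A z) x = inner (A x) z"
      using sym[OF SB[OF zS] SB[OF xS]] by (simp add: inner_commute)
    ultimately have "\<mu> + 2 * t * inner (A x) z + t\<^sup>2 * inner (A z) z
        \<le> \<mu> * (1 + 2 * t * inner x z + t\<^sup>2 * inner z z)"
      using qx ix by (simp add: inner_add_left inner_add_right inner_commute algebra_simps power2_eq_square)
    moreover have "inner z z = \<mu> * inner x z - inner (A x) z"
      unfolding z_def[of] by (simp add: inner_diff_left)
    then have iz: "inner (A x) z = \<mu> * inner x z - inner z z" by simp
    ultimately show ?thesis unfolding iz by (simp add: algebra_simps)
  qed
  have "inner z z = 0"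
  proof (rule ccontr)
    assume "inner z z \<noteq> 0"
    then have pos: "0 < inner z z" using inner_ge_zero[of z] by linarith
    define c where "c = \<mu> * inner z z - inner (A z) z"
    have c: "0 \<le> c" using qle[OF zS] by (simp add: c_def)
    \<comment> \<open>close to the minimiser of the quadratic in \<open>key\<close>; the \<open>1\<close> covers \<open>c = 0\<close>\<close>
    define t where "t = - inner z z / (c + 1)"
    have "t * (c + 1) = - inner z z" and "t < 0"
      unfolding t_def using c pos by (simp_all add: divide_neg_pos)
    then have "t\<^sup>2 * (c + 1) = - t * inner z z"
      by (simp add: power2_eq_square mult.assoc)
    moreover have "0 \<le> t\<^sup>2" "t * inner z z < 0"
      using \<open>t < 0\<close> pos by (simp_all add: mult_neg_pos)
    ultimately have "2 * t * inner z z + t\<^sup>2 * c < 0"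
      unfolding distrib_left mult_1_right mult.assoc mult_minus_left by linarith
    then show False using key[of t] by (simp add: c_def)
  qed
  then have "A x = \<mu> *\<^sub>R x" by (simp add: z_def)
  with xS nx show thesis by (rule that)
qed

text \<open>An orthonormal system of eigenvectors of maximal size spans \<open>V\<close>: otherwise its orthogonal
  complement in \<open>V\<close>, which is invariant by symmetry, contains a further eigenvector.\<close>

lemma orthonormal_eigenbasis_exists:
  fixes A :: "'b::real_inner \<Rightarrow> 'b"
  assumes "finite B" "V = span B"
    and inv: "\<And>x. x \<in> V \<Longrightarrow> A x \<in> V"
    and add: "\<And>x y. x \<in> V \<Longrightarrow> y \<in> V \<Longrightarrow> A (x + y) = A x + A y"
    and scale: "\<And>r x. x \<in> V \<Longrightarrow> A (r *\<^sub>R x) = r *\<^sub>R A x"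
    and sym: "\<And>x y. x \<in> V \<Longrightarrow> y \<in> V \<Longrightarrow> inner (A x) y = inner x (A y)"
  obtains E where "finite E" "orthonormal E" "span E = V"
    "\<And>e. e \<in> E \<Longrightarrow> A e = inner (A e) e *\<^sub>R e"
proof -
  let ?P = "\<lambda>E. finite E \<and> orthonormal E \<and> E \<subseteq> V \<and> (\<forall>e\<in>E. \<exists>\<mu>. A e = \<mu> *\<^sub>R e)"
  have bound: "card E \<le> card B" if "?P E" for E
  proof -
    have "0 \<notin> E" using that by (auto simp: orthonormal_def)
    then have "independent E"
      using that by (intro pairwise_orthogonal_independent) (auto simp: orthonormal_def)
    then show ?thesis
      using independent_span_bound[OF assms(1)] that assms(2) by auto
  qed
  have "\<exists>E. ?P E \<and> (\<forall>F. ?P F \<longrightarrow> card F \<le> card E)"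
    by (rule ex_has_greatest_nat[of _ "{}" _ "Suc (card B)"])
       (use bound in \<open>auto simp: orthonormal_def less_Suc_eq_le\<close>)
  then obtain E where E: "?P E" and max: "\<And>F. ?P F \<Longrightarrow> card F \<le> card E"
    by blast
  have EV: "span E \<subseteq> V" using E assms(2) by (metis span_minimal subspace_span)
  have "V \<subseteq> span E"
  proof (rule ccontr)
    assume "\<not> V \<subseteq> span E"
    then obtain v where v: "v \<in> V" "v \<notin> span E" by blast
    define K where "K = {x. \<forall>e\<in>E. inner x e = 0}"
    define S where "S = V \<inter> K"
    define x0 where "x0 = v - (\<Sum>e\<in>E. inner v e *\<^sub>R e)"
    have sumE: "(\<Sum>e\<in>E. inner v e *\<^sub>R e) \<in> span E"
      by (auto intro!: span_sum span_scale intro: span_base)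
    have subV: "subspace V" using assms(2) by simp
    have "x0 \<in> S"
      unfolding S_def K_def x0_def using v sumE EV subV E
      by (auto intro: subspace_diff simp: inner_diff_left orthonormal_inner_sum)
    have "x0 \<noteq> 0" using v(2) sumE by (auto simp: x0_def)
    have subS: "subspace S"
      unfolding S_def K_def using subV
      by (auto simp: subspace_def inner_add_left)
    have "K = (\<Inter>e\<in>E. {x. inner x e = 0})" by (auto simp: K_def)
    then have "closed K" by (auto intro!: closed_INT closed_Collect_eq continuous_intros)
    have invS: "A x \<in> S" if x: "x \<in> S" for x
    proof -
      have "inner (A x) e = 0" if e: "e \<in> E" for e
      proof -
        obtain \<mu> where "A e = \<mu> *\<^sub>R e" using E e by blast
        then show ?thesis using sym[of x e] x e E by (auto simp: S_def K_def)
      qed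
      then show ?thesis using x inv by (auto simp: S_def K_def)
    qed
    obtain x \<mu> where x: "x \<in> S" "norm x = 1" "A x = \<mu> *\<^sub>R x"
      by (rule eigenvector_exists[of B S K x0 A])
         (use assms \<open>x0 \<in> S\<close> \<open>x0 \<noteq> 0\<close> subS \<open>closed K\<close> invS in \<open>auto simp: S_def\<close>)
    have "x \<notin> E" using x by (auto simp: S_def K_def norm_eq_1)
    have "?P (insert x E)"
      using E x by (auto simp: orthonormal_def S_def K_def pairwise_insert orthogonal_def inner_commute)
    from max[OF this] show False using \<open>x \<notin> E\<close> E by simp
  qed
  with EV have "span E = V" by blast
  moreover have "A e = inner (A e) e *\<^sub>R e" if e: "e \<in> E" for e
  proof -
    obtain \<mu> where "A e = \<mu> *\<^sub>R e" using E e by blast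
    moreover have "inner e e = 1" using E e by (auto simp: orthonormal_def norm_eq_1)
    ultimately show ?thesis by simp
  qed
  ultimately show thesis using E that by blast
qed

lemma riesz_eqI:
  assumes "subspace V" "w \<in> V" "\<And>\<psi>. \<psi> \<in> V \<Longrightarrow> inner w \<psi> = l \<psi>"
  shows "riesz V l = w"
  unfolding riesz_def
proof (rule the_equality)
  fix w' assume w': "w' \<in> V \<and> (\<forall>\<psi>\<in>V. inner w' \<psi> = l \<psi>)"
  then have "w' - w \<in> V" using assms by (auto intro: subspace_diff)
  then have "inner (w' - w) (w' - w) = 0"
    using w' assms(3) by (simp add: inner_diff_left)
  then show "w' = w" by simp
qed (use assms in auto)

lemma riesz_props:
  fixes V :: "'b::real_inner set"
  assumes "finite B" "V = span B"
    and add: "\<And>x y. x \<in> V \<Longrightarrow> y \<in> V \<Longrightarrow> l (x + y) = l x + l y"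
    and scale: "\<And>r x. x \<in> V \<Longrightarrow> l (r *\<^sub>R x) = r * l x"
  shows "riesz V l \<in> V" "\<psi> \<in> V \<Longrightarrow> inner (riesz V l) \<psi> = l \<psi>"
proof -
  obtain E where E: "finite E" "orthonormal E" "span E = V"
    using orthonormal_basis_exists[OF assms(1)] assms(2) by metis
  have subV: "subspace V" using assms(2) by simp
  have EV: "E \<subseteq> V" using E(3) span_base by blast
  define w where "w = (\<Sum>e\<in>E. l e *\<^sub>R e)"
  have wV: "w \<in> V" unfolding w_def using subV EV by (auto intro!: subspace_sum subspace_scale)
  have lsum: "l (\<Sum>e\<in>F. k e *\<^sub>R e) = (\<Sum>e\<in>F. k e * l e)" if "finite F" "F \<subseteq> E" for F k
    using that
  proof (induction rule: finite_induct)
    case empty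
    show ?case using scale[of 0 0] subV by (simp add: subspace_0)
  next
    case (insert e F)
    have "(\<Sum>e\<in>F. k e *\<^sub>R e) \<in> V" "e \<in> V" "k e *\<^sub>R e \<in> V"
      using insert.prems subV EV by (auto intro!: subspace_sum subspace_scale)
    then show ?case using insert by (simp add: add scale)
  qed
  have wl: "inner w \<psi> = l \<psi>" if \<psi>: "\<psi> \<in> V" for \<psi>
  proof -
    have "l \<psi> = (\<Sum>e\<in>E. inner \<psi> e * l e)"
      using lsum[OF E(1) subset_refl, of "inner \<psi>"] orthonormal_expansion[OF E(2,1), of \<psi>] \<psi> E(3)
      by simp
    moreover have "inner w \<psi> = (\<Sum>e\<in>E. l e * inner e \<psi>)"
      by (simp only: w_def inner_sum_left inner_scaleR_left)
    ultimately show ?thesis by (simp add: inner_commute[of \<psi>] mult.commute)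
  qed
  have "riesz V l = w" using subV wV wl by (rule riesz_eqI)
  then show "riesz V l \<in> V" "\<psi> \<in> V \<Longrightarrow> inner (riesz V l) \<psi> = l \<psi>" using wV wl by auto
qed

text \<open>In an orthonormal eigenbasis the sum over eigenvalues and eigenprojections becomes a sum over
  the basis: the eigenspace of \<open>\<mu>\<close> is spanned by the basis vectors with eigenvalue \<open>\<mu>\<close>.\<close>

lemma spectral_fun_eigenbasis:
  fixes A :: "'b::real_inner \<Rightarrow> 'b"
  assumes E: "finite E" "orthonormal E" "span E = V"
    and inv: "\<And>x. x \<in> V \<Longrightarrow> A x \<in> V"
    and sym: "\<And>x y. x \<in> V \<Longrightarrow> y \<in> V \<Longrightarrow> inner (A x) y = inner x (A y)"
    and eig: "\<And>e. e \<in> E \<Longrightarrow> A e = lam e *\<^sub>R e"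
  shows "spectral_fun V A g u = (\<Sum>e\<in>E. (g (lam e) * inner u e) *\<^sub>R e)"
proof -
  have EV: "E \<subseteq> V" using E(3) span_base by blast
  have subV: "subspace V" using E(3) by auto
  have Ax: "inner (A x) e = lam e * inner x e" if "x \<in> V" "e \<in> E" for x e
    using sym[of x e] that EV eig by auto
  have mem: "x \<in> eigenspace V A \<mu> \<longleftrightarrow> x \<in> V \<and> (\<forall>e\<in>E. lam e \<noteq> \<mu> \<longrightarrow> inner x e = 0)" for x \<mu>
  proof
    assume x: "x \<in> eigenspace V A \<mu>"
    then have xV: "x \<in> V" and "A x = \<mu> *\<^sub>R x" by (auto simp: eigenspace_def)
    then have "lam e * inner x e = \<mu> * inner x e" if "e \<in> E" for e
      using Ax[OF xV that] by (metis inner_scaleR_left)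
    then show "x \<in> V \<and> (\<forall>e\<in>E. lam e \<noteq> \<mu> \<longrightarrow> inner x e = 0)"
      using xV by (metis mult_cancel_right)
  next
    assume x: "x \<in> V \<and> (\<forall>e\<in>E. lam e \<noteq> \<mu> \<longrightarrow> inner x e = 0)"
    then have xV: "x \<in> V" by simp
    have "A x = (\<Sum>e\<in>E. inner (A x) e *\<^sub>R e)"
      using orthonormal_expansion[OF E(2,1)] inv[OF xV] E(3) by blast
    also have "\<dots> = (\<Sum>e\<in>E. (\<mu> * inner x e) *\<^sub>R e)"
      using Ax[OF xV] x by (intro sum.cong) auto
    also have "\<dots> = \<mu> *\<^sub>R (\<Sum>e\<in>E. inner x e *\<^sub>R e)" by (simp add: scaleR_sum_right)
    also have "(\<Sum>e\<in>E. inner x e *\<^sub>R e) = x"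
      using orthonormal_expansion[OF E(2,1)] xV E(3) by metis
    finally show "x \<in> eigenspace V A \<mu>" using xV by (simp add: eigenspace_def)
  qed
  have subspace_eigenspace: "subspace (eigenspace V A \<mu>)" for \<mu>
    using subV by (auto simp: subspace_def mem inner_add_left)
  have vals: "eigenvalues V A = lam ` E"
  proof (intro equalityI subsetI)
    fix \<mu> assume "\<mu> \<in> eigenvalues V A"
    then obtain w where w: "w \<in> eigenspace V A \<mu>" "w \<noteq> 0" by (auto simp: eigenvalues_def)
    show "\<mu> \<in> lam ` E"
    proof (rule ccontr)
      assume "\<mu> \<notin> lam ` E"
      then have "\<forall>e\<in>E. inner w e = 0" using w(1) by (auto simp: mem)
      moreover have "w = (\<Sum>e\<in>E. inner w e *\<^sub>R e)"
        using orthonormal_expansion[OF E(2,1), of w] w(1) E(3) by (auto simp: mem)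
      ultimately show False using w(2) by simp
    qed
  next
    fix \<mu> assume "\<mu> \<in> lam ` E"
    then obtain e where e: "e \<in> E" "\<mu> = lam e" by auto
    then have "e \<in> eigenspace V A \<mu>" "e \<noteq> 0"
      using EV eig E(2) by (auto simp: eigenspace_def orthonormal_def)
    then show "\<mu> \<in> eigenvalues V A" by (auto simp: eigenvalues_def)
  qed
  have proj: "riesz (eigenspace V A \<mu>) (inner u) = (\<Sum>e\<in>{e\<in>E. lam e = \<mu>}. inner u e *\<^sub>R e)"
    (is "_ = ?p") for \<mu>
  proof (rule riesz_eqI[OF subspace_eigenspace])
    have p: "?p = (\<Sum>e\<in>E. (if lam e = \<mu> then inner u e else 0) *\<^sub>R e)"
      by (rule sum.mono_neutral_cong_left) (use E(1) in auto)
    have pV: "?p \<in> V" using subV EV by (auto intro!: subspace_sum subspace_scale)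
    then show "?p \<in> eigenspace V A \<mu>"
      unfolding mem using p orthonormal_inner_sum[OF E(2,1)] by auto
    fix \<psi> assume "\<psi> \<in> eigenspace V A \<mu>"
    then have \<psi>: "\<psi> \<in> V" "\<forall>e\<in>E. lam e \<noteq> \<mu> \<longrightarrow> inner \<psi> e = 0" by (auto simp: mem)
    have "inner u \<psi> = (\<Sum>e\<in>E. inner \<psi> e * inner u e)"
      using orthonormal_parseval[OF E(2,1), of \<psi> u] \<psi>(1) E(3) by (simp add: inner_commute)
    moreover have "inner ?p \<psi> = (\<Sum>e\<in>E. inner \<psi> e * inner u e)"
      unfolding p inner_sum_left by (rule sum.cong) (use \<psi>(2) in \<open>auto simp: inner_commute\<close>)
    ultimately show "inner ?p \<psi> = inner u \<psi>" by simp
  qed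
  have "spectral_fun V A g u
      = (\<Sum>\<mu>\<in>lam ` E. \<Sum>e\<in>{e\<in>E. lam e = \<mu>}. (g (lam e) * inner u e) *\<^sub>R e)"
    unfolding spectral_fun_def vals using E(1)
    by (auto simp: infsum_finite proj scaleR_sum_right intro!: sum.cong)
  also have "\<dots> = (\<Sum>e\<in>E. (g (lam e) * inner u e) *\<^sub>R e)"
    by (rule sum.group) (use E(1) in auto)
  finally show ?thesis .
qed


section \<open>The nonlinearity\<close>

lemma abs_poly_le:
  fixes p :: "real poly"
  obtains K where "0 \<le> K" "\<And>y. \<bar>poly p y\<bar> \<le> K * (1 + \<bar>y\<bar> ^ degree p)"
proof
  let ?K = "\<Sum>i\<le>degree p. \<bar>coeff p i\<bar>"
  show "0 \<le> ?K" by (simp add: sum_nonneg)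
  show "\<bar>poly p y\<bar> \<le> ?K * (1 + \<bar>y\<bar> ^ degree p)" for y
  proof -
    have "\<bar>coeff p i * y ^ i\<bar> \<le> \<bar>coeff p i\<bar> * (1 + \<bar>y\<bar> ^ degree p)" if i: "i \<le> degree p" for i
    proof -
      have "\<bar>y\<bar> ^ i \<le> 1 + \<bar>y\<bar> ^ degree p"
      proof (cases "\<bar>y\<bar> \<le> 1")
        case True
        then have "\<bar>y\<bar> ^ i \<le> 1" by (simp add: power_le_one)
        then show ?thesis using zero_le_power[of "\<bar>y\<bar>" "degree p"] by linarith
      next
        case False
        then have "\<bar>y\<bar> ^ i \<le> \<bar>y\<bar> ^ degree p" using i by (intro power_increasing) auto
        then show ?thesis by linarith
      qed
      then show ?thesis by (simp add: abs_mult power_abs mult_left_mono)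
    qed
    then have "(\<Sum>i\<le>degree p. \<bar>coeff p i * y ^ i\<bar>) \<le> ?K * (1 + \<bar>y\<bar> ^ degree p)"
      unfolding sum_distrib_right by (intro sum_mono) auto
    then show ?thesis
      unfolding poly_altdef by (rule order_trans[OF sum_abs])
  qed
qed

lemma borel_measurable_poly [measurable]:
  fixes p :: "real poly"
  shows "poly p \<in> borel_measurable borel"
  by (intro borel_measurable_continuous_onI continuous_intros)

lemma averaged_f_mult_diff:
  assumes "pderiv F = f"
  shows "averaged_f f u u' x * (rep_l2 u' x - rep_l2 u x) = poly F (rep_l2 u' x) - poly F (rep_l2 u x)"
proof -
  define a b where "a = rep_l2 u x" and "b = rep_l2 u' x"
  have "((\<lambda>\<theta>. poly f (a + \<theta> * (b - a)) * (b - a)) has_integral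
      poly F (a + 1 * (b - a)) - poly F (a + 0 * (b - a))) {0..1}"
  proof (rule fundamental_theorem_of_calculus)
    fix \<theta> :: real
    have "((\<lambda>\<theta>. poly F (a + \<theta> * (b - a))) has_real_derivative poly f (a + \<theta> * (b - a)) * (b - a))
        (at \<theta> within {0..1})"
      unfolding assms[symmetric]
      by (rule DERIV_chain2[OF poly_DERIV]) (auto intro!: derivative_eq_intros)
    then show "((\<lambda>\<theta>. poly F (a + \<theta> * (b - a))) has_vector_derivative poly f (a + \<theta> * (b - a)) * (b - a))
        (at \<theta> within {0..1})"
      by (simp add: has_real_derivative_iff_has_vector_derivative)
  qed simp
  from integral_unique[OF this] show ?thesis
    unfolding averaged_f_def a_def[symmetric] b_def[symmetric] by simp
qed

text \<open>The form as a difference quotient shows that the average over \<open>\<theta>\<close> is a measurable function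
  of \<open>x\<close>.\<close>

lemma averaged_f_eq:
  assumes "pderiv F = f"
  shows "averaged_f f u u' x = (if rep_l2 u' x = rep_l2 u x then poly f (rep_l2 u x)
    else (poly F (rep_l2 u' x) - poly F (rep_l2 u x)) / (rep_l2 u' x - rep_l2 u x))"
  using averaged_f_mult_diff[OF assms, of u u' x]
  by (auto simp: eq_divide_eq averaged_f_def)

lemma borel_measurable_averaged_f:
  assumes "pderiv F = f"
  shows "averaged_f f u u' \<in> borel_measurable borel"
  unfolding averaged_f_eq[OF assms, abs_def] by measurable

lemma averaged_f_abs_le:
  assumes K: "0 \<le> K" "\<And>y. \<bar>poly f y\<bar> \<le> K * (1 + \<bar>y\<bar> ^ n)"
  shows "\<bar>averaged_f f u u' x\<bar> \<le> K * (1 + (\<bar>rep_l2 u x\<bar> + \<bar>rep_l2 u' x\<bar>) ^ n)"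
proof -
  define a b where "a = rep_l2 u x" and "b = rep_l2 u' x"
  have "norm (poly f (a + \<theta> * (b - a))) \<le> K * (1 + (\<bar>a\<bar> + \<bar>b\<bar>) ^ n)" if "\<theta> \<in> {0..1}" for \<theta>
  proof -
    have "\<bar>a + \<theta> * (b - a)\<bar> = \<bar>(1 - \<theta>) * a + \<theta> * b\<bar>" by (simp add: algebra_simps)
    also have "\<dots> \<le> (1 - \<theta>) * \<bar>a\<bar> + \<theta> * \<bar>b\<bar>"
      using that abs_triangle_ineq[of "(1 - \<theta>) * a" "\<theta> * b"] by (simp add: abs_mult)
    also have "\<dots> \<le> \<bar>a\<bar> + \<bar>b\<bar>"
      using that by (intro add_mono mult_left_le_one_le) auto
    finally have "\<bar>a + \<theta> * (b - a)\<bar> ^ n \<le> (\<bar>a\<bar> + \<bar>b\<bar>) ^ n" by (intro power_mono) auto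
    then have "K * (1 + \<bar>a + \<theta> * (b - a)\<bar> ^ n) \<le> K * (1 + (\<bar>a\<bar> + \<bar>b\<bar>) ^ n)"
      using K(1) by (intro mult_left_mono) auto
    then show ?thesis using K(2)[of "a + \<theta> * (b - a)"] by simp
  qed
  then have "norm (integral (cbox 0 1) (\<lambda>\<theta>. poly f (a + \<theta> * (b - a))))
      \<le> K * (1 + (\<bar>a\<bar> + \<bar>b\<bar>) ^ n) * Henstock_Kurzweil_Integration.content (cbox 0 (1::real))"
    using K(1) by (intro integrable_bound integrable_continuous continuous_intros) (auto simp: cbox_interval)
  then show ?thesis by (simp add: averaged_f_def a_def b_def)
qed

lemma power4_add_le: "((x::real) + y) ^ 4 \<le> 8 * (x ^ 4 + y ^ 4)"
proof -
  have sq: "(a + b)\<^sup>2 \<le> 2 * (a\<^sup>2 + b\<^sup>2)" for a b :: real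
    using sum_squares_bound[of a b] by (simp add: power2_sum)
  have double: "(2 * s)\<^sup>2 = 4 * s\<^sup>2" for s :: real by (simp add: power_mult_distrib)
  have "((x + y)\<^sup>2)\<^sup>2 \<le> (2 * (x\<^sup>2 + y\<^sup>2))\<^sup>2" by (intro power_mono sq) simp
  also have "\<dots> \<le> 4 * (2 * ((x\<^sup>2)\<^sup>2 + (y\<^sup>2)\<^sup>2))"
    unfolding double using sq[of "x\<^sup>2" "y\<^sup>2"] by (intro mult_left_mono) auto
  finally show ?thesis by simp
qed

text \<open>A pointwise substitute for Hoelder's inequality with exponents \<open>4/3\<close> and \<open>4\<close>.\<close>

lemma cubic_mult_le:
  assumes "0 \<le> (x::real)" "0 \<le> y"
  shows "(1 + x ^ 3) * y \<le> 2 + 16 * (x ^ 4 + y ^ 4)"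
proof -
  define m where "m = x + y"
  have m: "0 \<le> m" "x \<le> m" "y \<le> m" using assms by (auto simp: m_def)
  have "(1 + x ^ 3) * y \<le> (1 + m ^ 3) * m"
    using assms m by (intro mult_mono add_left_mono power_mono) auto
  also have "\<dots> = m + m ^ 4" by (simp add: algebra_simps power_def numeral_eq_Suc)
  also have "\<dots> \<le> 2 + 2 * m ^ 4"
  proof (cases "m \<le> 1")
    case True
    then show ?thesis using zero_le_power[OF m(1), of 4] by linarith
  next
    case False
    then have "m ^ 1 \<le> m ^ 4" by (intro power_increasing) auto
    then show ?thesis by simp
  qed
  also have "\<dots> \<le> 2 + 16 * (x ^ 4 + y ^ 4)"
    using power4_add_le[of x y] by (simp add: m_def)
  finally show ?thesis .
qed

lemma set_integrable_bounded_const: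
  assumes "open D" "bounded D"
  shows "set_integrable lborel D (\<lambda>_ :: 'a::euclidean_space. c :: real)"
proof -
  have "emeasure lborel D < \<infinity>" using assms(2) by (rule emeasure_bounded_finite)
  then show ?thesis using assms(1)
    unfolding set_integrable_def
    by (intro integrable_real_mult_indicator integrable_mult_left integrable_real_indicator | simp)+
qed

lemma integrable_imp_set_integrable:
  fixes g :: "'a::euclidean_space \<Rightarrow> real"
  assumes "open D" "integrable lborel g"
  shows "set_integrable lborel D g"
  unfolding set_integrable_def using assms by (intro integrable_mult_indicator) auto

lemma set_integrable_poly_rep_l2:
  fixes u :: "'a::euclidean_space l2"
  assumes D: "open D" "bounded D" and p: "degree p = 4"
    and u: "integrable lborel (\<lambda>x. (rep_l2 u x) ^ 4)"
  shows "set_integrable lborel D (\<lambda>x. poly p (rep_l2 u x))"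
proof -
  obtain K where K: "0 \<le> K" "\<And>y. \<bar>poly p y\<bar> \<le> K * (1 + \<bar>y\<bar> ^ degree p)"
    by (rule abs_poly_le[of p]) blast
  have "set_integrable lborel D (\<lambda>x. K + K * (rep_l2 u x) ^ 4)"
    by (intro set_integral_add set_integrable_bounded_const set_integrable_mult_right
        integrable_imp_set_integrable D u)
  then show ?thesis
  proof (rule set_integrable_bound)
    have [measurable]: "D \<in> sets borel" using D(1) by simp
    show "set_borel_measurable lborel D (\<lambda>x. poly p (rep_l2 u x))"
      unfolding set_borel_measurable_def by measurable
    show "AE x in lborel. x \<in> D \<longrightarrow> norm (poly p (rep_l2 u x)) \<le> norm (K + K * (rep_l2 u x) ^ 4)"
      using K by (auto simp: p distrib_left)
  qed
qed

lemma set_integrable_averaged_f_mult: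
  fixes u :: "'a::euclidean_space l2"
  assumes D: "open D" "bounded D" and f: "degree f = 3" "pderiv F = f"
    and L4: "integrable lborel (\<lambda>x. (rep_l2 u x) ^ 4)" "integrable lborel (\<lambda>x. (rep_l2 u' x) ^ 4)"
      "integrable lborel (\<lambda>x. (rep_l2 \<psi> x) ^ 4)"
  shows "set_integrable lborel D (\<lambda>x. averaged_f f u u' x * rep_l2 \<psi> x)"
proof -
  obtain K where K: "0 \<le> K" "\<And>y. \<bar>poly f y\<bar> \<le> K * (1 + \<bar>y\<bar> ^ degree f)"
    by (rule abs_poly_le[of f]) blast
  let ?b = "\<lambda>x. 2 * K + 128 * K * ((rep_l2 u x) ^ 4 + (rep_l2 u' x) ^ 4 + (rep_l2 \<psi> x) ^ 4)"
  have "set_integrable lborel D ?b"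
    by (intro set_integral_add set_integrable_bounded_const set_integrable_mult_right
        integrable_imp_set_integrable D L4)
  then show ?thesis
  proof (rule set_integrable_bound)
    have [measurable]: "D \<in> sets borel" using D(1) by simp
    note [measurable] = borel_measurable_averaged_f[OF f(2)]
    show "set_borel_measurable lborel D (\<lambda>x. averaged_f f u u' x * rep_l2 \<psi> x)"
      unfolding set_borel_measurable_def by measurable
    have "\<bar>averaged_f f u u' x * rep_l2 \<psi> x\<bar> \<le> ?b x" for x
    proof -
      define a b c where "a = \<bar>rep_l2 u x\<bar>" and "b = \<bar>rep_l2 u' x\<bar>" and "c = \<bar>rep_l2 \<psi> x\<bar>"
      have "\<bar>averaged_f f u u' x * rep_l2 \<psi> x\<bar> \<le> K * (1 + (a + b) ^ 3) * c"
        using averaged_f_abs_le[OF K, of u u' x]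
        by (simp add: abs_mult a_def b_def c_def f mult_right_mono)
      also have "\<dots> \<le> K * (2 + 16 * ((a + b) ^ 4 + c ^ 4))"
        using cubic_mult_le[of "a + b" c] K(1) by (simp add: mult.assoc mult_left_mono a_def b_def c_def)
      also have "\<dots> \<le> K * (2 + 16 * (8 * (a ^ 4 + b ^ 4) + 8 * c ^ 4))"
      proof -
        have "(a + b) ^ 4 + c ^ 4 \<le> 8 * (a ^ 4 + b ^ 4) + 8 * c ^ 4"
          using power4_add_le[of a b] zero_le_power[of c 4] unfolding c_def by linarith
        then show ?thesis using K(1) by (intro mult_left_mono) auto
      qed
      finally show ?thesis by (simp add: a_def b_def c_def algebra_simps)
    qed
    then show "AE x in lborel. x \<in> D \<longrightarrow> norm (averaged_f f u u' x * rep_l2 \<psi> x) \<le> norm (?b x)"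
      by (intro AE_I2 impI) (metis abs_ge_self order_trans real_norm_def)
  qed
qed

lemma pairing_add:
  assumes "D \<in> sets borel" "g \<in> borel_measurable borel"
    and "set_integrable lborel D (\<lambda>x. g x * rep_l2 \<phi> x)" "set_integrable lborel D (\<lambda>x. g x * rep_l2 \<psi> x)"
  shows "pairing D g (\<phi> + \<psi>) = pairing D g \<phi> + pairing D g \<psi>"
proof -
  note [measurable] = assms(1,2)
  have "pairing D g (\<phi> + \<psi>) = (LINT x:D|lborel. g x * rep_l2 \<phi> x + g x * rep_l2 \<psi> x)"
    unfolding pairing_def set_lebesgue_integral_def
  proof (rule integral_cong_AE)
    show "AE x in lborel. indicator D x *\<^sub>R (g x * rep_l2 (\<phi> + \<psi>) x)
        = indicator D x *\<^sub>R (g x * rep_l2 \<phi> x + g x * rep_l2 \<psi> x)"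
      using rep_l2_add[of \<phi> \<psi>] by eventually_elim (simp add: distrib_left)
  qed measurable
  then show ?thesis using set_integral_add(2)[OF assms(3,4)] by (simp add: pairing_def)
qed

lemma pairing_scaleR:
  assumes "D \<in> sets borel" "g \<in> borel_measurable borel"
  shows "pairing D g (r *\<^sub>R \<psi>) = r * pairing D g \<psi>"
proof -
  note [measurable] = assms
  have "pairing D g (r *\<^sub>R \<psi>) = (LINT x:D|lborel. r * (g x * rep_l2 \<psi> x))"
    unfolding pairing_def set_lebesgue_integral_def
  proof (rule integral_cong_AE)
    show "AE x in lborel. indicator D x *\<^sub>R (g x * rep_l2 (r *\<^sub>R \<psi>) x)
        = indicator D x *\<^sub>R (r * (g x * rep_l2 \<psi> x))"
      using rep_l2_scaleR[of r \<psi>] by eventually_elim (simp add: mult_ac)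
  qed measurable
  then show ?thesis by (simp add: pairing_def)
qed

text \<open>Testing the averaged nonlinearity with the increment gives the increment of the potential
  energy: pointwise this is the fundamental theorem of calculus along the segment from \<open>u(x)\<close> to
  \<open>u'(x)\<close>.\<close>

lemma pairing_averaged_f_diff:
  fixes u :: "'a::euclidean_space l2"
  assumes D: "open D" "bounded D" and f: "degree f = 3" "pderiv F = f"
    and L4: "integrable lborel (\<lambda>x. (rep_l2 u x) ^ 4)" "integrable lborel (\<lambda>x. (rep_l2 u' x) ^ 4)"
  shows "pairing D (averaged_f f u u') (u' - u)
    = (LINT x:D|lborel. poly F (rep_l2 u' x)) - (LINT x:D|lborel. poly F (rep_l2 u x))"
proof -
  have [measurable]: "D \<in> sets borel" using D by simp
  note [measurable] = borel_measurable_averaged_f[OF f(2)]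
  have F: "degree F = 4" using f degree_pderiv[of F] by simp
  have "pairing D (averaged_f f u u') (u' - u)
      = (LINT x:D|lborel. poly F (rep_l2 u' x) - poly F (rep_l2 u x))"
    unfolding pairing_def set_lebesgue_integral_def
  proof (rule integral_cong_AE)
    show "AE x in lborel. indicator D x *\<^sub>R (averaged_f f u u' x * rep_l2 (u' - u) x)
        = indicator D x *\<^sub>R (poly F (rep_l2 u' x) - poly F (rep_l2 u x))"
      using rep_l2_diff[of u' u] by eventually_elim (simp add: averaged_f_mult_diff[OF f(2)])
  qed measurable
  also have "\<dots> = (LINT x:D|lborel. poly F (rep_l2 u' x)) - (LINT x:D|lborel. poly F (rep_l2 u x))"
    by (intro set_integral_diff(2) set_integrable_poly_rep_l2 D F L4)
  finally show ?thesis .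
qed


section \<open>One step of the scheme\<close>

text \<open>In a single eigenmode the step is the exact flow of the oscillator \<open>u'' + l u = -G\<close> with constant
  force, that is, a rotation about the shifted equilibrium \<open>-G/l\<close>. For \<open>l = 0\<close> the powers
  \<open>l powr a\<close> are zero by convention and the step is the identity.\<close>

lemma mode_energy:
  fixes l \<tau> u v G u' w :: real
  defines "C \<equiv> cos (\<tau> * l powr (1/2))" and "S \<equiv> sin (\<tau> * l powr (1/2))"
  assumes "0 \<le> l"
    and u': "u' = C * u + l powr (-1/2) * (S * v) - l powr (-1) * (G - C * G)"
    and w: "w = - (l powr (1/2) * (S * u)) + C * v - l powr (-1/2) * (S * G)"
  shows "l * u'\<^sup>2 + w\<^sup>2 + 2 * (G * (u' - u)) = l * u\<^sup>2 + v\<^sup>2"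
proof (cases "l = 0")
  case True
  then show ?thesis using u' w by (simp add: C_def)
next
  case False
  define \<omega> where "\<omega> = l powr (1/2)"
  have l: "0 < l" using False assms(3) by simp
  then have \<omega>: "0 < \<omega>" "\<omega>\<^sup>2 = l" by (simp_all add: \<omega>_def powr_half_sqrt)
  have inv: "l powr (-1/2) = 1 / \<omega>" "l powr (-1) = 1 / \<omega>\<^sup>2"
    using l \<omega>(2) by (simp_all add: \<omega>_def powr_minus_divide)
  have CS: "C\<^sup>2 + S\<^sup>2 = 1" by (simp add: C_def S_def)
  \<comment> \<open>\<open>(l u + G, \<omega> v)\<close> is \<open>\<omega>\<close> times the phase point \<open>(\<omega> (u + G/l), v)\<close> relative to the equilibrium\<close>
  have rot: "l * u' + G = C * (l * u + G) + S * (\<omega> * v)"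
    unfolding u' inv unfolding \<omega>(2)[symmetric] using \<omega>(1) by (simp add: field_simps power2_eq_square)
  have rot': "\<omega> * w = C * (\<omega> * v) - S * (l * u + G)"
    unfolding w inv \<omega>_def[symmetric] unfolding \<omega>(2)[symmetric] using \<omega>(1)
    by (simp add: field_simps power2_eq_square)
  have "(l * u' + G)\<^sup>2 + (\<omega> * w)\<^sup>2 = (C\<^sup>2 + S\<^sup>2) * ((l * u + G)\<^sup>2 + (\<omega> * v)\<^sup>2)"
    unfolding rot rot' by (simp add: power2_eq_square algebra_simps)
  then have "(l * u' + G)\<^sup>2 + l * w\<^sup>2 = (l * u + G)\<^sup>2 + l * v\<^sup>2"
    by (simp add: CS power_mult_distrib \<omega>(2))
  then have "l * (l * u'\<^sup>2 + w\<^sup>2 + 2 * (G * (u' - u))) = l * (l * u\<^sup>2 + v\<^sup>2)"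
    by (simp add: power2_eq_square algebra_simps)
  then show ?thesis using False by simp
qed

text \<open>The spectral facts about the discrete Laplacian that the energy balance uses. Linearity and
  symmetry hold because the operator represents the bilinear form \<^term>\<open>grad_inner D\<close> on \<open>V\<^sub>h\<close>.\<close>

lemma laplacian_h_eigenbasis:
  fixes Vh :: "'a::euclidean_space l2 set"
  assumes "open D" "Vh \<subseteq> H01 D" "finite B" "Vh = span B"
  obtains E lam where "finite E" "orthonormal E" "span E = Vh" "\<forall>e\<in>E. 0 \<le> lam e"
    "\<forall>x\<in>Vh. grad_inner D x x = (\<Sum>e\<in>E. lam e * (inner x e)\<^sup>2)"
    "\<forall>g x. fun_h D Vh g x = (\<Sum>e\<in>E. (g (lam e) * inner x e) *\<^sub>R e)"
proof -
  let ?A = "laplacian_h D Vh"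
  have subV: "subspace Vh" using assms(4) by simp
  have H01: "x \<in> H01 D" if "x \<in> Vh" for x using that assms(2) by blast
  have A: "?A x \<in> Vh" "y \<in> Vh \<Longrightarrow> inner (?A x) y = grad_inner D x y" for x y
    unfolding laplacian_h_def
    by (rule riesz_props[OF assms(3,4)];
        use assms(1,2) in \<open>auto simp: grad_inner_add_right grad_inner_scaleR_right subset_eq\<close>)+
  have sym: "inner (?A x) y = inner x (?A y)" if "x \<in> Vh" "y \<in> Vh" for x y
    using A(2) that by (metis grad_inner_commute inner_commute)
  have add: "?A (x + y) = ?A x + ?A y" if "x \<in> Vh" "y \<in> Vh" for x y
    unfolding laplacian_h_def[of D Vh "x + y"]
  proof (rule riesz_eqI[OF subV])
    show "?A x + ?A y \<in> Vh" using subV A(1) by (intro subspace_add)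
    show "inner (?A x + ?A y) \<psi> = grad_inner D (x + y) \<psi>" if "\<psi> \<in> Vh" for \<psi>
      using A(2)[OF that] grad_inner_add_right[OF assms(1) H01[OF \<open>x \<in> Vh\<close>] H01[OF \<open>y \<in> Vh\<close>]]
      by (simp add: inner_add_left grad_inner_commute[of D _ \<psi>])
  qed
  have scale: "?A (r *\<^sub>R x) = r *\<^sub>R ?A x" if "x \<in> Vh" for r x
    unfolding laplacian_h_def[of D Vh "r *\<^sub>R x"]
  proof (rule riesz_eqI[OF subV])
    show "r *\<^sub>R ?A x \<in> Vh" using subV A(1) by (intro subspace_scale)
    show "inner (r *\<^sub>R ?A x) \<psi> = grad_inner D (r *\<^sub>R x) \<psi>" if "\<psi> \<in> Vh" for \<psi>
      using A(2)[OF that] grad_inner_scaleR_right[OF assms(1) H01[OF \<open>x \<in> Vh\<close>]]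
      by (simp add: grad_inner_commute[of D _ \<psi>])
  qed
  obtain E where E: "finite E" "orthonormal E" "span E = Vh"
    and eig: "\<And>e. e \<in> E \<Longrightarrow> ?A e = inner (?A e) e *\<^sub>R e"
    using orthonormal_eigenbasis_exists[OF assms(3,4) A(1) add scale sym] by metis
  define lam where "lam e = inner (?A e) e" for e
  have EV: "e \<in> Vh" if "e \<in> E" for e using that E(3) span_base by blast
  show thesis
  proof (rule that[OF E, of lam]; intro ballI allI)
    show "0 \<le> lam e" if "e \<in> E" for e
      using A(2)[OF EV[OF that], of e] grad_inner_nonneg[of D e] by (simp add: lam_def)
    show "fun_h D Vh g x = (\<Sum>e\<in>E. (g (lam e) * inner x e) *\<^sub>R e)" for g x
      unfolding fun_h_def using E A(1) sym eig
      by (intro spectral_fun_eigenbasis) (auto simp: lam_def)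
    fix x assume x: "x \<in> Vh"
    have "grad_inner D x x = (\<Sum>e\<in>E. inner (?A x) e * inner x e)"
      using A[of x] x orthonormal_parseval[OF E(2,1), of "?A x" x] E(3) by simp
    also have "\<dots> = (\<Sum>e\<in>E. lam e * (inner x e)\<^sup>2)"
    proof (rule sum.cong)
      fix e assume e: "e \<in> E"
      have "inner (?A x) e = inner x (lam e *\<^sub>R e)"
        using sym[OF x EV[OF e]] eig[OF e] by (simp add: lam_def)
      then show "inner (?A x) e * inner x e = lam e * (inner x e)\<^sup>2"
        by (simp add: power2_eq_square)
    qed simp
    finally show "grad_inner D x x = (\<Sum>e\<in>E. lam e * (inner x e)\<^sup>2)" .
  qed
qed

text \<open>Summing the energy balance of the modes gives the balance of the quadratic part, with \<open>G\<close> doing the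
  work \<open>- \<langle>G, u' - u\<rangle>\<close>; this is minus the increment of the potential part.\<close>

lemma scheme_step_energy:
  fixes Vh :: "'a::euclidean_space l2 set"
  assumes dim: "DIM('a) = 1 \<or> DIM('a) = 2" and D: "open D" "bounded D"
    and f: "degree f = 3" "pderiv F = f"
    and Vh: "Vh \<subseteq> H01 D" "finite B" "Vh = span B"
    and mem: "u \<in> Vh" "v \<in> Vh" "u' \<in> Vh"
    and step: "scheme_step D Vh f \<tau> dw u v u' v'"
  shows "energy D F C1 u' (v' - P_h Vh (inner dw)) = energy D F C1 u v"
proof -
  obtain E lam where E: "finite E" "orthonormal E" "span E = Vh"
    and lam: "\<And>e. e \<in> E \<Longrightarrow> 0 \<le> lam e"
    and grad: "\<And>x. x \<in> Vh \<Longrightarrow> grad_inner D x x = (\<Sum>e\<in>E. lam e * (inner x e)\<^sup>2)"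
    and fun_h: "\<And>g x. fun_h D Vh g x = (\<Sum>e\<in>E. (g (lam e) * inner x e) *\<^sub>R e)"
    by (rule laplacian_h_eigenbasis[OF D(1) Vh]) blast
  have subV: "subspace Vh" using Vh(3) by simp
  have L4: "integrable lborel (\<lambda>x. (rep_l2 \<psi> x) ^ 4)" if "\<psi> \<in> Vh" for \<psi>
    using H01_L4[OF dim] Vh(1) that by blast
  have Dm: "D \<in> sets borel" using D(1) by simp
  define G where "G = P_h Vh (pairing D (averaged_f f u u'))"
  define w where "w = v' - P_h Vh (inner dw)"
  note lin = pairing_add[OF Dm borel_measurable_averaged_f[OF f(2)]]
    pairing_scaleR[OF Dm borel_measurable_averaged_f[OF f(2)]]
    set_integrable_averaged_f_mult[OF D f] L4 mem
  have G: "G \<in> Vh" "\<And>\<psi>. \<psi> \<in> Vh \<Longrightarrow> inner G \<psi> = pairing D (averaged_f f u u') \<psi>"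
    unfolding G_def P_h_def by (rule riesz_props[OF Vh(2,3)]; simp add: lin)+
  have u'_eq: "u' = C_h D Vh \<tau> u + pow_h D Vh (-1/2) (S_h D Vh \<tau> v)
      - pow_h D Vh (-1) (G - C_h D Vh \<tau> G)"
    and w_eq: "w = - pow_h D Vh (1/2) (S_h D Vh \<tau> u) + C_h D Vh \<tau> v
      - pow_h D Vh (-1/2) (S_h D Vh \<tau> G)"
    using step by (simp_all add: scheme_step_def Let_def G_def w_def)
  have fun_h_mem: "fun_h D Vh g x \<in> Vh" for g x
  proof -
    have "e \<in> Vh" if "e \<in> E" for e using that E(3) span_base by blast
    then show ?thesis unfolding fun_h using subV by (auto intro!: subspace_sum subspace_scale)
  qed
  have wV: "w \<in> Vh"
    unfolding w_eq pow_h_def C_h_def S_h_def using subV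
    by (simp add: fun_h_mem subspace_diff subspace_add subspace_neg)
  have coord: "inner (fun_h D Vh g x) e = g (lam e) * inner x e" if "e \<in> E" for g x e
    unfolding fun_h by (rule orthonormal_inner_sum[OF E(2,1) that])
  have mode: "lam e * (inner u' e)\<^sup>2 + (inner w e)\<^sup>2 + 2 * (inner G e * (inner u' e - inner u e))
      = lam e * (inner u e)\<^sup>2 + (inner v e)\<^sup>2" if e: "e \<in> E" for e
    by (rule mode_energy[of _ _ \<tau>, OF lam[OF e]]; subst u'_eq w_eq)
       (simp_all add: pow_h_def C_h_def S_h_def inner_add_left inner_diff_left coord[OF e])
  have norm_sq: "(norm x)\<^sup>2 = (\<Sum>e\<in>E. (inner x e)\<^sup>2)" if "x \<in> Vh" for x
    unfolding power2_norm_eq_inner using orthonormal_parseval[OF E(2,1), of x x] that E(3)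
    by (simp add: power2_eq_square)
  have diff: "u' - u \<in> Vh" using subV mem by (intro subspace_diff)
  have "inner G (u' - u) = (\<Sum>e\<in>E. inner G e * (inner u' e - inner u e))"
    using orthonormal_parseval[OF E(2,1), of G "u' - u"] G(1) E(3) by (simp add: inner_diff_left)
  then have "grad_inner D u' u' + (norm w)\<^sup>2 + 2 * inner G (u' - u)
      = (\<Sum>e\<in>E. lam e * (inner u' e)\<^sup>2 + (inner w e)\<^sup>2 + 2 * (inner G e * (inner u' e - inner u e)))"
    by (simp add: grad norm_sq mem wV sum.distrib sum_distrib_left)
  also have "\<dots> = (\<Sum>e\<in>E. lam e * (inner u e)\<^sup>2 + (inner v e)\<^sup>2)"
    by (rule sum.cong) (simp_all add: mode)
  also have "\<dots> = grad_inner D u u + (norm v)\<^sup>2"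
    by (simp add: grad norm_sq mem sum.distrib)
  finally have "grad_inner D u' u' + (norm w)\<^sup>2 + 2 * inner G (u' - u) = grad_inner D u u + (norm v)\<^sup>2" .
  moreover have "inner G (u' - u)
      = (LINT x:D|lborel. poly F (rep_l2 u' x)) - (LINT x:D|lborel. poly F (rep_l2 u x))"
    unfolding G(2)[OF diff] by (rule pairing_averaged_f_diff[OF D f L4 L4]) (use mem in auto)
  ultimately show ?thesis unfolding energy_def w_def[symmetric] by simp
qed

theorem lemma4p2:
  fixes D :: "(real ^ 'n::finite) set"
    and M :: "'w measure" and Ft :: "real \<Rightarrow> 'w measure"
    and T \<tau> \<gamma> a1 a2 b1 b2 c C1 :: real
    and N p0 :: nat
    and f F :: "real poly"
    and Q :: "(real ^ 'n) l2 \<Rightarrow> (real ^ 'n) l2"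
    and W :: "real \<Rightarrow> 'w \<Rightarrow> (real ^ 'n) l2"
    and u0 v0 :: "'w \<Rightarrow> (real ^ 'n) l2"
    and Vh :: "(real ^ 'n) l2 set"
    and U V Vbar dW :: "nat \<Rightarrow> 'w \<Rightarrow> (real ^ 'n) l2"
  assumes "CARD('n) = 1 \<or> CARD('n) = 2"
    and "polygonal_domain D"
    and "0 < T"
    and "prob_space M" and "normal_filtration M Ft T"
    and "admissible_nonlinearity D f F a1 a2 b1 b2 c"
    and "b1 \<le> C1"
    and "1 \<le> \<gamma>" and "CARD('n) = 2 \<longrightarrow> \<gamma> \<le> 3"
    and "selfadjoint_psd D Q"
    and "\<forall>u\<in>L2 D. op_sqrt D Q u \<in> dom_laplacian_pow D ((\<gamma> - 1) / 2)"
    and "hilbert_schmidt D (\<lambda>u. laplacian_pow D ((\<gamma> - 1) / 2) (op_sqrt D Q u))"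
    and "Q_Wiener_process M Ft T D Q W"
    and "(\<lambda>\<omega>. (u0 \<omega>, v0 \<omega>)) \<in> borel_measurable (Ft 0)"
    and "AE \<omega> in M. u0 \<omega> \<in> Hdot D \<gamma> \<and> v0 \<omega> \<in> Hdot D (\<gamma> - 1)"
    and "1 \<le> p0" and "integrable M (\<lambda>\<omega>. norm_HH D \<gamma> (u0 \<omega>, v0 \<omega>) ^ p0)"
    and "Vh \<subseteq> H01 D" and "\<exists>B. finite B \<and> Vh = span B"
    and "1 \<le> N" and "\<tau> = T / real N"
    and "\<forall>n \<omega>. dW n \<omega> = W (real (Suc n) * \<tau>) \<omega> - W (real n * \<tau>) \<omega>"
    and "\<forall>n\<le>N. U n \<in> borel_measurable M \<and> V n \<in> borel_measurable M \<and>
           (\<forall>\<omega>\<in>space M. U n \<omega> \<in> Vh \<and> V n \<omega> \<in> Vh)"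
    and "AE \<omega> in M. U 0 \<omega> = P_h Vh (inner (u0 \<omega>)) \<and> V 0 \<omega> = P_h Vh (inner (v0 \<omega>))"
    and "\<forall>n<N. AE \<omega> in M.
           scheme_step D Vh f \<tau> (dW n \<omega>) (U n \<omega>) (V n \<omega>) (U (Suc n) \<omega>) (V (Suc n) \<omega>)"
    and "\<forall>n<N. \<forall>\<omega>. Vbar (Suc n) \<omega> = V (Suc n) \<omega> - P_h Vh (inner (dW n \<omega>))"
  shows "\<forall>n<N. AE \<omega> in M.
           energy D F C1 (U (Suc n) \<omega>) (Vbar (Suc n) \<omega>) = energy D F C1 (U n \<omega>) (V n \<omega>)"
proof (intro allI impI)
  fix n assume n: "n < N"
  have D: "open D" "bounded D" using assms(2) by (auto simp: polygonal_domain_def)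
  have f: "degree f = 3" "pderiv F = f" using assms(6) by (auto simp: admissible_nonlinearity_def)
  have dim: "DIM(real ^ 'n) = 1 \<or> DIM(real ^ 'n) = 2" using assms(1) by simp
  obtain B where B: "finite B" "Vh = span B" using assms(19) by blast
  have mem: "U n \<omega> \<in> Vh" "V n \<omega> \<in> Vh" "U (Suc n) \<omega> \<in> Vh" if "\<omega> \<in> space M" for \<omega>
    using assms(23) n that by auto
  have "AE \<omega> in M. scheme_step D Vh f \<tau> (dW n \<omega>) (U n \<omega>) (V n \<omega>) (U (Suc n) \<omega>) (V (Suc n) \<omega>)"
    using assms(25) n by blast
  then show "AE \<omega> in M.
      energy D F C1 (U (Suc n) \<omega>) (Vbar (Suc n) \<omega>) = energy D F C1 (U n \<omega>) (V n \<omega>)"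
    using AE_space
  proof eventually_elim
    case (elim \<omega>)
    have "Vbar (Suc n) \<omega> = V (Suc n) \<omega> - P_h Vh (inner (dW n \<omega>))"
      using assms(26) n by blast
    then show ?case
      using scheme_step_energy[OF dim D f assms(18) B mem[OF elim(2)] elim(1)] by simp
  qed
qed

end
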